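(* Let $G$ and $F$ be locally compact second countable groups, let $Y\subseteq G$ be a clopen set, and let $\alpha: Y\rightarrow F$ be a mixed piecewise affine map. Let $\phi_\alpha: A(F)\to B(G)$ be the homomorphism given by $\phi_\alpha(u)(t)=u(\alpha(t))$ for $t\in Y$ and $\phi_\alpha(u)(t)=0$ for $t\in G\setminus Y$. The following are equivalent: (1) The map $\phi_\alpha:A(F)\to B(G)$ extends to a bounded $w^*$-continuous homomorphism from $L^\infty(F)$ to $L^\infty(G)$. (2) $\alpha$ is an open map.
   Context: $L^\infty(F)$ and $L^\infty(G)$ are taken with respect to Haar measures $\nu$ on $F$ and $\mu$ on $G$, and the $w^*$ topologies are those coming from the preduals $L^1(F)$, $L^1(G)$. The Fourier-Stieltjes algebra $B(G)$ is the set of all coefficient functions $s\mapsto(\pi(s)\xi,\eta)$, $\xi,\eta\in H_\pi$, of (continuous) unitary representations $(\pi,H_\pi)$ of $G$; the Fourier algebra $A(F)$ consists of the coefficients of the left regular representation $s\mapsto\lambda_s$ on $L^2(F)$, $\lambda_s\xi(t)=\xi(s^{-1}t)$. Both are algebras under pointwise operations, and $A(F)\subseteq L^\infty(F)$, $B(G)\subseteq L^\infty(G)$. Affine maps: let $K$ be a subgroup of $G$ and $C$ a left coset of $K$ in $G$. A map $\alpha: C\to F$ is affine (resp. anti-affine) if there exist a homomorphism (resp. anti-homomorphism) $\theta:K\to F$ and elements $s_0\in F$, $t_0\in G$ such that $C=t_0^{-1}K$ and $\alpha(t)=s_0\theta(t_0t)$ for all $t\in C$. The open coset ring $\Omega_0(G)$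 is the smallest ring of subsets of $G$ containing the open cosets (cosets of open subgroups). Mixed piecewise affine maps: for $Y\subseteq G$ clopen, a map $\alpha:Y\to F$ is mixed piecewise affine if there exist pairwise disjoint clopen sets $Y_1,\dots,Y_m\in\Omega_0(G)$ with $Y=\bigcup_{i=1}^m Y_i$, open cosets $C_i$ of $G$ with $Y_i\subseteq C_i$, and continuous maps $\alpha_i:C_i\to F$, each of which is affine or anti-affine, such that $\alpha|_{Y_i}=\alpha_i|_{Y_i}$ for all $i$. (For such $\alpha$, $\phi_\alpha$ does map $A(F)$ into $B(G)$.) *)

theory Defs
  imports "HOL-Analysis.Analysis" "HOL-Probability.Essential_Supremum"
begin

text \<open>
  A (Hausdorff) second countable topological group is a type of class
  \<open>{topological_group_add, second_countable_topology, t2_space}\<close>.  The class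
  \<open>topological_group_add\<close> does not assume commutativity: only the notation is additive, so
  \<open>s + t\<close> stands for the product $st$, \<open>- t\<close> for $t^{-1}$ and \<open>0\<close> for the identity.  The order
  of the summands matters everywhere below.
\<close>


section \<open>Haar measure\<close>

text \<open>
  Left Haar measures: nonzero left-invariant Radon measures on the Borel sets.
\<close>

definition haar_measure :: "'g::topological_group_add measure \<Rightarrow> bool" where
  "haar_measure M \<longleftrightarrow>
     sets M = sets borel \<and>
     emeasure M UNIV \<noteq> 0 \<and>
     (\<forall>K. compact K \<longrightarrow> emeasure M K < \<infinity>) \<and>
     (\<forall>A\<in>sets borel. emeasure M A = (INF U\<in>{U. open U \<and> A \<subseteq> U}. emeasure M U)) \<and>
     (\<forall>U. open U \<longrightarrow> emeasure M U = (SUP K\<in>{K. compact K \<and> K \<subseteq> U}. emeasure M K)) \<and>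
     (\<forall>s. \<forall>A\<in>sets borel. emeasure M ((+) s ` A) = emeasure M A)"


section \<open>Function spaces\<close>

text \<open>
  Elements of $L^1$, $L^2$ and $L^\infty$ are represented by functions; equality in these spaces
  is equality almost everywhere.
\<close>

definition L1 :: "'a measure \<Rightarrow> ('a \<Rightarrow> complex) set" where
  "L1 M = {f. integrable M f}"

definition L2 :: "'a measure \<Rightarrow> ('a \<Rightarrow> complex) set" where
  "L2 M = {f \<in> borel_measurable M. integrable M (\<lambda>x. (cmod (f x))\<^sup>2)}"

definition Linf_norm :: "'a measure \<Rightarrow> ('a \<Rightarrow> complex) \<Rightarrow> ereal" where
  "Linf_norm M f = esssup M (\<lambda>x. ereal (cmod (f x)))"

definition Linf :: "'a measure \<Rightarrow> ('a \<Rightarrow> complex) set" where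
  "Linf M = {f \<in> borel_measurable M. Linf_norm M f < \<infinity>}"

text \<open>
  The coarsest topology on $L^\infty$ for which $f \mapsto \int f h$ is continuous for every
  $h \in L^1$.  On representatives it is not Hausdorff: functions that agree almost everywhere
  are not separated by it.
\<close>

definition wstar_topology :: "'a measure \<Rightarrow> ('a \<Rightarrow> complex) topology" where
  "wstar_topology M =
     pullback_topology (Linf M) (\<lambda>f. \<lambda>h\<in>L1 M. \<integral>x. f x * h x \<partial>M)
       (product_topology (\<lambda>_. euclidean) (L1 M))"

text \<open>
  Maps $L^\infty(M) \to L^\infty(N)$, given on representatives: the second conjunct says that
  the map is well defined on classes, the others that it is an algebra homomorphism.
\<close>

definition Linf_hom ::
  "'a measure \<Rightarrow> 'b measure \<Rightarrow> (('a \<Rightarrow> complex) \<Rightarrow> ('b \<Rightarrow> complex)) \<Rightarrow> bool" where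
  "Linf_hom M N \<Phi> \<longleftrightarrow>
     \<Phi> \<in> Linf M \<rightarrow> Linf N \<and>
     (\<forall>f\<in>Linf M. \<forall>g\<in>Linf M. (AE x in M. f x = g x) \<longrightarrow> (AE y in N. \<Phi> f y = \<Phi> g y)) \<and>
     (\<forall>f\<in>Linf M. \<forall>g\<in>Linf M. AE y in N. \<Phi> (\<lambda>x. f x + g x) y = \<Phi> f y + \<Phi> g y) \<and>
     (\<forall>c. \<forall>f\<in>Linf M. AE y in N. \<Phi> (\<lambda>x. c * f x) y = c * \<Phi> f y) \<and>
     (\<forall>f\<in>Linf M. \<forall>g\<in>Linf M. AE y in N. \<Phi> (\<lambda>x. f x * g x) y = \<Phi> f y * \<Phi> g y)"

definition Linf_bounded ::
  "'a measure \<Rightarrow> 'b measure \<Rightarrow> (('a \<Rightarrow> complex) \<Rightarrow> ('b \<Rightarrow> complex)) \<Rightarrow> bool" where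
  "Linf_bounded M N \<Phi> \<longleftrightarrow>
     (\<exists>C::real. \<forall>f\<in>Linf M. Linf_norm N (\<Phi> f) \<le> ereal C * Linf_norm M f)"


section \<open>The Fourier algebra\<close>

definition left_regular :: "'g::group_add \<Rightarrow> ('g \<Rightarrow> complex) \<Rightarrow> ('g \<Rightarrow> complex)" where
  "left_regular s \<xi> = (\<lambda>t. \<xi> (- s + t))"

definition fourier_algebra :: "'g::topological_group_add measure \<Rightarrow> ('g \<Rightarrow> complex) set" where
  "fourier_algebra M =
     {u. \<exists>\<xi>\<in>L2 M. \<exists>\<eta>\<in>L2 M. \<forall>s. u s = (\<integral>t. left_regular s \<xi> t * cnj (\<eta> t) \<partial>M)}"


section \<open>Cosets and mixed piecewise affine maps\<close>

definition add_subgroup :: "'g::group_add set \<Rightarrow> bool" where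
  "add_subgroup K \<longleftrightarrow> 0 \<in> K \<and> (\<forall>x\<in>K. \<forall>y\<in>K. x + y \<in> K) \<and> (\<forall>x\<in>K. - x \<in> K)"

text \<open>
  Left cosets suffice: the right coset $Kt$ is the left coset $t(t^{-1}Kt)$ of a conjugate.
\<close>

definition open_cosets :: "'g::topological_group_add set set" where
  "open_cosets = {(+) t ` K | t K. add_subgroup K \<and> open K}"

definition open_coset_ring :: "'g::topological_group_add set set" where
  "open_coset_ring = \<Inter>{R. ring_of_sets UNIV R \<and> open_cosets \<subseteq> R}"

text \<open>
  The subgroup \<open>K\<close> is determined by its left coset \<open>C\<close>, so quantifying over it here is harmless.
\<close>

definition affine_map :: "'g::group_add set \<Rightarrow> ('g \<Rightarrow> 'f::group_add) \<Rightarrow> bool" where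
  "affine_map C \<alpha> \<longleftrightarrow>
     (\<exists>K \<theta> s0 t0. add_subgroup K \<and> (\<forall>x\<in>K. \<forall>y\<in>K. \<theta> (x + y) = \<theta> x + \<theta> y) \<and>
        C = (+) (- t0) ` K \<and> (\<forall>t\<in>C. \<alpha> t = s0 + \<theta> (t0 + t)))"

definition anti_affine_map :: "'g::group_add set \<Rightarrow> ('g \<Rightarrow> 'f::group_add) \<Rightarrow> bool" where
  "anti_affine_map C \<alpha> \<longleftrightarrow>
     (\<exists>K \<theta> s0 t0. add_subgroup K \<and> (\<forall>x\<in>K. \<forall>y\<in>K. \<theta> (x + y) = \<theta> y + \<theta> x) \<and>
        C = (+) (- t0) ` K \<and> (\<forall>t\<in>C. \<alpha> t = s0 + \<theta> (t0 + t)))"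

text \<open>
  A map \<open>\<alpha> : Y \<rightarrow> F\<close> is a total function whose values outside \<open>Y\<close> are irrelevant.
\<close>

definition mixed_piecewise_affine ::
  "'g::topological_group_add set \<Rightarrow> ('g \<Rightarrow> 'f::topological_group_add) \<Rightarrow> bool" where
  "mixed_piecewise_affine Y \<alpha> \<longleftrightarrow>
     (\<exists>(m::nat) Ys Cs \<alpha>s.
        disjoint_family_on Ys {1..m} \<and>
        Y = (\<Union>i\<in>{1..m}. Ys i) \<and>
        (\<forall>i\<in>{1..m}.
           open (Ys i) \<and> closed (Ys i) \<and> Ys i \<in> open_coset_ring \<and>
           Cs i \<in> open_cosets \<and> Ys i \<subseteq> Cs i \<and>
           continuous_on (Cs i) (\<alpha>s i) \<and>
           (affine_map (Cs i) (\<alpha>s i) \<or> anti_affine_map (Cs i) (\<alpha>s i)) \<and>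
           (\<forall>t\<in>Ys i. \<alpha> t = \<alpha>s i t)))"


section \<open>The induced map and its extensions\<close>

definition induced_map ::
  "'g set \<Rightarrow> ('g \<Rightarrow> 'f) \<Rightarrow> ('f \<Rightarrow> complex) \<Rightarrow> ('g \<Rightarrow> complex)" where
  "induced_map Y \<alpha> u = (\<lambda>t. if t \<in> Y then u (\<alpha> t) else 0)"

text \<open>
  For mixed piecewise affine \<open>\<alpha>\<close>, \<open>induced_map Y \<alpha>\<close> maps the Fourier algebra $A(F)$ into the
  Fourier-Stieltjes algebra $B(G) \subseteq L^\infty(G)$.  In the extension property only the
  classes in $L^\infty(G)$ of the functions \<open>induced_map Y \<alpha> u\<close> matter, so $B(G)$ does not
  appear explicitly.
\<close>

definition extends_to_wstar_hom ::
  "'f::topological_group_add measure \<Rightarrow> 'g measure \<Rightarrow>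
     (('f \<Rightarrow> complex) \<Rightarrow> ('g \<Rightarrow> complex)) \<Rightarrow> bool" where
  "extends_to_wstar_hom \<nu> \<mu> \<phi> \<longleftrightarrow>
     (\<exists>\<Phi>. Linf_hom \<nu> \<mu> \<Phi> \<and> Linf_bounded \<nu> \<mu> \<Phi> \<and>
        continuous_map (wstar_topology \<nu>) (wstar_topology \<mu>) \<Phi> \<and>
        (\<forall>u\<in>fourier_algebra \<nu>. AE t in \<mu>. \<Phi> u t = \<phi> u t))"

end

theory Submission
  imports Defs
begin

text \<open>
  Write \<open>\<phi>\<close> for the induced map.  The link between the two conditions is the behaviour of \<open>\<alpha>\<close> on null sets.

  Suppose that \<open>\<alpha>\<close> is open.  Each piece of \<open>\<alpha>\<close> that lives on a nonempty set is the restriction of an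
  affine or anti-affine map whose image contains a nonempty open set.  For such maps a Fubini argument
  shows that preimages of null sets are null (\<open>antihom_preimage_null\<close>, \<open>hom_preimage_null\<close>).  Hence
  \<open>f \<mapsto> \<phi> f\<close> makes sense on all of $L^\infty(F)$, where it is a contractive homomorphism, and the
  Radon-Nikodym theorem yields a pre-adjoint $L^1(G) \to L^1(F)$ (\<open>preadjoint_nonneg\<close>), which makes it
  weak-star continuous.

  Conversely, let \<open>\<Phi>\<close> be an extension and \<open>K \<subseteq> Y\<close> compact of positive measure.  The indicator of the
  compact set \<open>\<alpha> ` K\<close> is the pointwise limit of a bounded sequence in the Fourier algebra, so if this set
  were null the sequence would tend to zero weak-star; its image under \<open>\<Phi>\<close> is however constantly one
  on \<open>K\<close>.  Hence \<open>\<alpha> ` K\<close> has positive measure (\<open>extension_image_not_null\<close>).  By the theorem of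
  Steinhaus and Weil the differences of elements of \<open>\<alpha> ` K\<close> contain a neighbourhood of the identity
  (\<open>steinhaus\<close>), and as each piece is compatible with the operation \<open>x - y + z\<close>, this makes \<open>\<alpha>\<close> open
  (\<open>heap_map_open\<close>).
\<close>

section \<open>Topological groups and Haar measure\<close>

text \<open>
  Rewrite rules for words in a noncommutative group: differences are removed, inverses are pushed to
  the atoms, and adjacent mutually inverse atoms inside a word cancel.
\<close>

lemmas group_normalize =
  diff_conv_add_uminus minus_add minus_minus add.assoc minus_add_cancel add_minus_cancel

lemma locally_compact_nbhd:
  fixes x :: "'a::t2_space"
  assumes "locally_compact_space (euclidean :: 'a topology)" "open U" "x \<in> U"
  obtains V K where "open V" "compact K" "x \<in> V" "V \<subseteq> K" "K \<subseteq> U"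
proof -
  have "Hausdorff_space (euclidean :: 'a topology)"
    unfolding Hausdorff_space_def by (auto simp: disjnt_def dest!: hausdorff)
  then have "neighbourhood_base_of (compactin euclidean) (euclidean :: 'a topology)"
    using locally_compact_space_neighbourhood_base[of "euclidean :: 'a topology"] assms(1) by simp
  then have "\<exists>V K. openin euclidean V \<and> compactin euclidean K \<and> x \<in> V \<and> V \<subseteq> K \<and> K \<subseteq> U"
    using assms(2,3) unfolding neighbourhood_base_of by (simp only: open_openin)
  then show thesis
    using that by (auto simp: open_openin[symmetric])
qed

lemma open_translation:
  fixes U :: "'a::topological_group_add set"
  assumes "open U"
  shows "open ((+) s ` U)"
proof -
  have "(+) s ` U = (\<lambda>x. - s + x) -` U"
  proof (rule set_eqI)
    fix x show "x \<in> (+) s ` U \<longleftrightarrow> x \<in> (\<lambda>x. - s + x) -` U"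
      by (auto simp: image_iff add.assoc[symmetric] intro!: bexI[of _ "- s + x"])
  qed
  moreover have "open ((\<lambda>x. - s + x) -` U)"
    by (intro open_vimage assms continuous_intros)
  ultimately show ?thesis by simp
qed

context
  fixes M :: "'g::{topological_group_add, second_countable_topology, t2_space} measure"
  assumes haar: "haar_measure M"
begin

lemma haar_sets: "sets M = sets borel"
  using haar by (simp add: haar_measure_def)

lemma haar_space: "space M = UNIV"
  using sets_eq_imp_space_eq[OF haar_sets] by simp

lemma haar_translation: "A \<in> sets borel \<Longrightarrow> emeasure M ((+) s ` A) = emeasure M A"
  using haar by (simp add: haar_measure_def)

lemma haar_translation_vimage:
  assumes "A \<in> sets borel"
  shows "emeasure M {y. s + y \<in> A} = emeasure M A"
proof -
  have "{y. s + y \<in> A} = (+) (- s) ` A"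
  proof (rule set_eqI)
    fix y show "y \<in> {y. s + y \<in> A} \<longleftrightarrow> y \<in> (+) (- s) ` A"
      by (auto simp: image_iff add.assoc[symmetric] intro!: bexI[of _ "s + y"])
  qed
  then show ?thesis using haar_translation[OF assms] by simp
qed

lemma haar_compact_finite: "compact K \<Longrightarrow> emeasure M K < \<infinity>"
  using haar by (simp add: haar_measure_def)

text \<open>
  If \<open>U\<close> were null, so would be each of its translates; by the Lindeloef property countably
  many of them cover the group, which would make \<open>M\<close> zero.
\<close>

lemma haar_open_pos:
  assumes "open U" "U \<noteq> {}"
  shows "emeasure M U > 0"
proof (rule ccontr)
  assume "\<not> ?thesis"
  then have null: "emeasure M U = 0" by simp
  obtain u where u: "u \<in> U" using assms by auto
  have cover: "\<Union>(range (\<lambda>s. (+) s ` U)) = UNIV"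
  proof -
    have "x \<in> (+) (x - u) ` U" for x using u by (force simp: image_iff)
    then show ?thesis by blast
  qed
  obtain F where F: "F \<subseteq> range (\<lambda>s. (+) s ` U)" "countable F" "\<Union>F = \<Union>(range (\<lambda>s. (+) s ` U))"
    using Lindelof[of "range (\<lambda>s. (+) s ` U)"] open_translation[OF assms(1)] by auto
  have "\<Union>F \<in> null_sets M"
  proof -
    have "A \<in> null_sets M" if AF: "A \<in> F" for A
    proof -
      obtain s where "A = (+) s ` U" using F(1) AF by blast
      then show ?thesis
        using null haar_translation[of U s] open_translation[OF assms(1), of s] assms(1)
        by (auto simp: null_sets_def haar_sets)
    qed
    then have "(\<Union>A\<in>F. A) \<in> null_sets M" by (intro null_sets_UN' F)
    then show ?thesis by simp
  qed
  then have "emeasure M UNIV = 0" using cover F(3) by (simp add: null_sets_def)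
  then show False using haar by (simp add: haar_measure_def)
qed

text \<open>
  By the Lindeloef property, countably many relatively compact open sets cover the group.
\<close>

lemma haar_sigma_finite:
  assumes "locally_compact_space (euclidean :: 'g topology)"
  shows "sigma_finite_measure M"
proof
  define R where "R = {V :: 'g set. open V \<and> (\<exists>K. compact K \<and> V \<subseteq> K)}"
  have "\<And>V. V \<in> R \<Longrightarrow> open V" by (simp add: R_def)
  then obtain F where F: "F \<subseteq> R" "countable F" "\<Union>F = \<Union>R"
    using Lindelof[of R] by metis
  have "x \<in> \<Union>R" for x
  proof -
    obtain V K where "open V" "compact K" "x \<in> V" "V \<subseteq> K"
      by (rule locally_compact_nbhd[OF assms open_UNIV UNIV_I])
    then show ?thesis unfolding R_def by blast
  qed
  then have "\<Union>F = UNIV" using F(3) by blast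
  moreover have fin: "emeasure M V \<noteq> \<infinity>" if VF: "V \<in> F" for V
  proof -
    obtain K where K: "compact K" "V \<subseteq> K" using subsetD[OF F(1) VF] by (auto simp: R_def)
    have "K \<in> sets M" using K(1) by (simp add: haar_sets compact_imp_closed)
    then have "emeasure M V \<le> emeasure M K" by (rule emeasure_mono[OF K(2)])
    then show ?thesis using haar_compact_finite[OF K(1)] by (auto simp: top_unique)
  qed
  moreover have "F \<subseteq> sets M"
    using F(1) by (auto simp: R_def haar_sets)
  ultimately show "\<exists>A. countable A \<and> A \<subseteq> sets M \<and> \<Union>A = space M \<and> (\<forall>a\<in>A. emeasure M a \<noteq> \<infinity>)"
    using F(2) by (metis haar_space)
qed

end

section \<open>Affine maps as maps of heaps\<close>

text \<open>
  A nonempty set is a coset of some subgroup iff it is closed under the ternary operation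
  $(x, y, z) \mapsto x y^{-1} z$; a set with this operation is called a heap.  Affine and
  anti-affine maps are those that preserve the operation, respectively reverse its order.
  Working with the operation avoids having to carry along the subgroup, the homomorphism on it
  and the two base points.
\<close>

definition heap_closed :: "'g::group_add set \<Rightarrow> bool" where
  "heap_closed C \<longleftrightarrow> (\<forall>x\<in>C. \<forall>y\<in>C. \<forall>z\<in>C. x - y + z \<in> C)"

definition heap_hom :: "'g::group_add set \<Rightarrow> ('g \<Rightarrow> 'f::group_add) \<Rightarrow> bool" where
  "heap_hom C f \<longleftrightarrow> (\<forall>x\<in>C. \<forall>y\<in>C. \<forall>z\<in>C. f (x - y + z) = f x - f y + f z)"

definition heap_antihom :: "'g::group_add set \<Rightarrow> ('g \<Rightarrow> 'f::group_add) \<Rightarrow> bool" where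
  "heap_antihom C f \<longleftrightarrow> (\<forall>x\<in>C. \<forall>y\<in>C. \<forall>z\<in>C. f (x - y + z) = f z - f y + f x)"

lemma hom_or_antihom_minus:
  fixes \<theta> :: "'g::group_add \<Rightarrow> 'f::group_add"
  assumes K: "add_subgroup K" and x: "x \<in> K"
    and \<theta>: "(\<forall>x\<in>K. \<forall>y\<in>K. \<theta> (x + y) = \<theta> x + \<theta> y) \<or> (\<forall>x\<in>K. \<forall>y\<in>K. \<theta> (x + y) = \<theta> y + \<theta> x)"
  shows "\<theta> (- x) = - \<theta> x"
proof -
  have mem: "0 \<in> K" "- x \<in> K" using K x by (simp_all add: add_subgroup_def)
  then have "\<theta> (0 + 0) = \<theta> 0 + \<theta> 0" using \<theta> by blast
  moreover have "\<theta> 0 = - \<theta> 0 + (\<theta> 0 + \<theta> 0)" by (simp add: add.assoc[symmetric])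
  ultimately have zero: "\<theta> 0 = 0" by simp
  have "\<theta> (x + - x) = \<theta> x + \<theta> (- x) \<or> \<theta> (- x + x) = \<theta> x + \<theta> (- x)"
    using \<theta> x mem(2) by blast
  then have "\<theta> x + \<theta> (- x) = 0" using zero by auto
  then show ?thesis by (rule minus_unique[symmetric])
qed

lemma open_coset_heap:
  assumes "C \<in> open_cosets"
  shows "open C" "heap_closed C"
proof -
  obtain t K where C: "C = (+) t ` K" and K: "add_subgroup K" "open K"
    using assms by (auto simp: open_cosets_def)
  show "open C" using C K open_translation by simp
  show "heap_closed C"
    unfolding heap_closed_def C
  proof (intro ballI)
    fix x y z assume "x \<in> (+) t ` K" "y \<in> (+) t ` K" "z \<in> (+) t ` K"
    then obtain a b c where abc: "x = t + a" "y = t + b" "z = t + c" "a \<in> K" "b \<in> K" "c \<in> K" by auto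
    have "x - y + z = t + (a + - b + c)"
      by (simp only: abc group_normalize)
    moreover have "- b \<in> K" using K(1) abc(5) by (simp add: add_subgroup_def)
    then have "a + - b + c \<in> K"
      using K(1) abc(4,6) by (simp add: add_subgroup_def del: add_uminus_conv_diff)
    ultimately show "x - y + z \<in> (+) t ` K" by (simp only: imageI)
  qed
qed

lemma affine_heap_hom:
  assumes "affine_map C f"
  shows "heap_hom C f"
proof -
  obtain K \<theta> s0 t0 where K: "add_subgroup K" and add: "\<forall>x\<in>K. \<forall>y\<in>K. \<theta> (x + y) = \<theta> x + \<theta> y"
    and C: "C = (+) (- t0) ` K" and f: "\<forall>t\<in>C. f t = s0 + \<theta> (t0 + t)"
    using assms unfolding affine_map_def by blast
  show ?thesis
    unfolding heap_hom_def
  proof (intro ballI)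
    fix x y z assume xyz: "x \<in> C" "y \<in> C" "z \<in> C"
    then obtain a b c where abc: "x = - t0 + a" "y = - t0 + b" "z = - t0 + c" "a \<in> K" "b \<in> K" "c \<in> K"
      using C by auto
    have e: "x - y + z = - t0 + (a + - b + c)"
      by (simp only: abc group_normalize)
    have Kb: "- b \<in> K" using K abc(5) by (simp add: add_subgroup_def)
    then have Kab: "a + - b \<in> K" using K abc(4) by (simp add: add_subgroup_def del: add_uminus_conv_diff)
    then have Kabc: "a + - b + c \<in> K" using K abc(6) by (simp add: add_subgroup_def del: add_uminus_conv_diff)
    have "x - y + z \<in> C" unfolding C e by (rule imageI[OF Kabc])
    then have "f (x - y + z) = s0 + \<theta> (t0 + (- t0 + (a + - b + c)))" using f unfolding e by blast
    also have "t0 + (- t0 + (a + - b + c)) = a + - b + c" by (rule add_minus_cancel)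
    also have "\<theta> (a + - b + c) = \<theta> (a + - b) + \<theta> c" using add Kab abc(6) by blast
    also have "\<theta> (a + - b) = \<theta> a + \<theta> (- b)" using add Kb abc(4) by blast
    also have "\<theta> (- b) = - \<theta> b" by (rule hom_or_antihom_minus[OF K abc(5) disjI1[OF add]])
    finally have "f (x - y + z) = s0 + (\<theta> a + - \<theta> b + \<theta> c)" by (simp only: add.assoc)
    moreover have "f x = s0 + \<theta> a" "f y = s0 + \<theta> b" "f z = s0 + \<theta> c"
      using bspec[OF f xyz(1)] bspec[OF f xyz(2)] bspec[OF f xyz(3)]
      unfolding abc(1-3) add_minus_cancel .
    ultimately show "f (x - y + z) = f x - f y + f z"
      by (simp only: group_normalize)
  qed
qed

lemma anti_affine_heap_antihom:
  assumes "anti_affine_map C f"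
  shows "heap_antihom C f"
proof -
  obtain K \<theta> s0 t0 where K: "add_subgroup K" and add: "\<forall>x\<in>K. \<forall>y\<in>K. \<theta> (x + y) = \<theta> y + \<theta> x"
    and C: "C = (+) (- t0) ` K" and f: "\<forall>t\<in>C. f t = s0 + \<theta> (t0 + t)"
    using assms unfolding anti_affine_map_def by blast
  show ?thesis
    unfolding heap_antihom_def
  proof (intro ballI)
    fix x y z assume xyz: "x \<in> C" "y \<in> C" "z \<in> C"
    then obtain a b c where abc: "x = - t0 + a" "y = - t0 + b" "z = - t0 + c" "a \<in> K" "b \<in> K" "c \<in> K"
      using C by auto
    have e: "x - y + z = - t0 + (a + - b + c)"
      by (simp only: abc group_normalize)
    have Kb: "- b \<in> K" using K abc(5) by (simp add: add_subgroup_def)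
    then have Kab: "a + - b \<in> K" using K abc(4) by (simp add: add_subgroup_def del: add_uminus_conv_diff)
    then have Kabc: "a + - b + c \<in> K" using K abc(6) by (simp add: add_subgroup_def del: add_uminus_conv_diff)
    have "x - y + z \<in> C" unfolding C e by (rule imageI[OF Kabc])
    then have "f (x - y + z) = s0 + \<theta> (t0 + (- t0 + (a + - b + c)))" using f unfolding e by blast
    also have "t0 + (- t0 + (a + - b + c)) = a + - b + c" by (rule add_minus_cancel)
    also have "\<theta> (a + - b + c) = \<theta> c + \<theta> (a + - b)" using add Kab abc(6) by blast
    also have "\<theta> (a + - b) = \<theta> (- b) + \<theta> a" using add Kb abc(4) by blast
    also have "\<theta> (- b) = - \<theta> b" by (rule hom_or_antihom_minus[OF K abc(5) disjI2[OF add]])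
    finally have "f (x - y + z) = s0 + (\<theta> c + - \<theta> b + \<theta> a)" by (simp only: add.assoc)
    moreover have "f x = s0 + \<theta> a" "f y = s0 + \<theta> b" "f z = s0 + \<theta> c"
      using bspec[OF f xyz(1)] bspec[OF f xyz(2)] bspec[OF f xyz(3)]
      unfolding abc(1-3) add_minus_cancel .
    ultimately show "f (x - y + z) = f z - f y + f x"
      by (simp only: group_normalize)
  qed
qed

section \<open>Preimages of null sets\<close>

text \<open>
  For fixed \<open>k\<close> the set of all \<open>y\<close> with \<open>f k + y \<in> N\<close> is a left translate of the null set \<open>N\<close>.
  By Fubini, for almost every \<open>y\<close> the set of all \<open>k \<in> C\<close> with \<open>f k + y \<in> N\<close> is null.  As the
  image of \<open>f\<close> contains a nonempty open set, which has positive measure, some such \<open>y\<close> has the form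
  \<open>- f c0 + f c1\<close>.  Since \<open>f\<close> reverses the heap operation,
  \<open>f k - f c0 + f c1 = f (c1 - c0 + k)\<close>, so that the null set obtained is a \<^emph>\<open>left\<close> translate of
  the preimage of \<open>N\<close>.  For a map that preserves the operation it would be a right translate, about
  which left invariance says nothing directly.
\<close>

lemma antihom_preimage_null:
  fixes \<mu> :: "'g::{topological_group_add, second_countable_topology, t2_space} measure"
    and \<nu> :: "'f::{topological_group_add, second_countable_topology, t2_space} measure"
  assumes lc: "locally_compact_space (euclidean :: 'g topology)"
      "locally_compact_space (euclidean :: 'f topology)"
    and haar: "haar_measure \<mu>" "haar_measure \<nu>"
    and C: "open C" "heap_closed C" and f: "continuous_on C f" "heap_antihom C f"
    and U: "open U" "U \<noteq> {}" "U \<subseteq> f ` C"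
    and N: "N \<in> null_sets \<nu>"
  shows "{k\<in>C. f k \<in> N} \<in> null_sets \<mu>"
proof -
  interpret M: sigma_finite_measure \<mu> by (rule haar_sigma_finite[OF haar(1) lc(1)])
  interpret V: sigma_finite_measure \<nu> by (rule haar_sigma_finite[OF haar(2) lc(2)])
  interpret P: pair_sigma_finite \<mu> \<nu> ..
  note [measurable_cong] = haar_sets[OF haar(1)] haar_sets[OF haar(2)]
  note [simp] = haar_space[OF haar(1)] haar_space[OF haar(2)]
  \<comment> \<open>extended by zero, a map that is continuous on an open set becomes Borel on the whole group\<close>
  define g where "g = (\<lambda>k. if k \<in> C then f k else 0)"
  have C_meas[measurable]: "C \<in> sets borel" using C by simp
  have g[measurable]: "g \<in> borel_measurable borel"
    unfolding g_def using f(1) C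
    by (intro borel_measurable_continuous_on_if) (auto simp: continuous_on_const)
  have N_meas[measurable]: "N \<in> sets borel" using N haar_sets[OF haar(2)] by auto
  define E where "E = {k\<in>C. f k \<in> N}"
  have E_eq: "E = {k. k \<in> C \<and> g k \<in> N}" by (auto simp: E_def g_def)
  have E_meas[measurable]: "E \<in> sets borel" unfolding E_eq by measurable
  have meas: "{x \<in> space (\<mu> \<Otimes>\<^sub>M \<nu>). \<not> (fst x \<in> C \<and> g (fst x) + snd x \<in> N)} \<in> sets (\<mu> \<Otimes>\<^sub>M \<nu>)"
  proof -
    have fst: "fst \<in> borel_measurable (\<mu> \<Otimes>\<^sub>M \<nu>)" and snd: "snd \<in> borel_measurable (\<mu> \<Otimes>\<^sub>M \<nu>)"
      using measurable_fst[of \<mu> \<nu>] measurable_snd[of \<mu> \<nu>]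
        measurable_cong_sets[OF refl haar_sets[OF haar(1)]] measurable_cong_sets[OF refl haar_sets[OF haar(2)]]
      by blast+
    have sum: "(\<lambda>x. g (fst x) + snd x) \<in> borel_measurable (\<mu> \<Otimes>\<^sub>M \<nu>)"
      by (intro borel_measurable_add measurable_compose[OF fst g] snd)
    have "{x \<in> space (\<mu> \<Otimes>\<^sub>M \<nu>). \<not> (fst x \<in> C \<and> g (fst x) + snd x \<in> N)}
        = space (\<mu> \<Otimes>\<^sub>M \<nu>) - (fst -` C \<inter> space (\<mu> \<Otimes>\<^sub>M \<nu>)) \<inter> ((\<lambda>x. g (fst x) + snd x) -` N \<inter> space (\<mu> \<Otimes>\<^sub>M \<nu>))"
      by blast
    then show ?thesis
      using measurable_sets[OF fst C_meas] measurable_sets[OF sum N_meas] by auto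
  qed
  have "AE y in \<nu>. \<not> (k \<in> C \<and> g k + y \<in> N)" for k
  proof (rule AE_I')
    have "emeasure \<nu> {y. g k + y \<in> N} = 0"
      using haar_translation_vimage[OF haar(2) N_meas] N by auto
    then show "{y. g k + y \<in> N} \<in> null_sets \<nu>"
      by (auto simp: null_sets_def)
  qed auto
  then have "AE k in \<mu>. AE y in \<nu>. \<not> (k \<in> C \<and> g k + y \<in> N)" by simp
  then have ae: "AE y in \<nu>. AE k in \<mu>. \<not> (k \<in> C \<and> g k + y \<in> N)"
    using P.AE_commute[OF meas] by simp
  obtain c0 where c0: "c0 \<in> C" using U by auto
  have "\<exists>y\<in>(+) (- f c0) ` U. AE k in \<mu>. \<not> (k \<in> C \<and> g k + y \<in> N)"
  proof (rule ccontr)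
    assume "\<not> ?thesis"
    then have "AE y in \<nu>. y \<notin> (+) (- f c0) ` U" using ae by (auto elim: eventually_mono)
    moreover have "(+) (- f c0) ` U \<in> sets \<nu>"
      using open_translation[OF U(1)] by (simp add: haar_sets[OF haar(2)])
    ultimately have "emeasure \<nu> ((+) (- f c0) ` U) = 0"
      by (simp add: AE_iff_null_sets[symmetric] null_setsD1)
    then show False
      using haar_open_pos[OF haar(2) open_translation[OF U(1), of "- f c0"]] U(2) by simp
  qed
  then obtain c1 where c1: "c1 \<in> C" and ae1: "AE k in \<mu>. \<not> (k \<in> C \<and> g k + (- f c0 + f c1) \<in> N)"
    using U(3) by blast
  have "k \<in> C \<and> g k + (- f c0 + f c1) \<in> N" if "(c1 - c0) + k \<in> E" for k
  proof -
    have j: "c1 - c0 + k \<in> C" "f (c1 - c0 + k) \<in> N" using that by (auto simp: E_def)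
    have "c0 - c1 + (c1 - c0 + k) \<in> C" using j c0 c1 C(2) by (auto simp: heap_closed_def)
    then have k: "k \<in> C" by (simp add: add.assoc[symmetric] algebra_simps)
    then have "f (c1 - c0 + k) = f k - f c0 + f c1" using f(2) c0 c1 by (auto simp: heap_antihom_def)
    then show ?thesis using j k by (simp add: g_def add.assoc[symmetric])
  qed
  then have "AE k in \<mu>. \<not> (c1 - c0) + k \<in> E" using ae1 by (auto elim: eventually_mono)
  then have "emeasure \<mu> {k. (c1 - c0) + k \<in> E} = 0"
    by (subst (asm) AE_iff_measurable[OF _ refl]) (auto simp: haar_sets[OF haar(1)])
  then have "emeasure \<mu> E = 0" using haar_translation_vimage[OF haar(1) E_meas] by simp
  then show ?thesis unfolding E_def[symmetric] by (auto simp: null_sets_def haar_sets[OF haar(1)])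
qed

text \<open>
  Inversion reverses the heap operation, so this is a case of the previous lemma; it stands in for
  the modular function.
\<close>

lemma inversion_null:
  fixes \<mu> :: "'g::{topological_group_add, second_countable_topology, t2_space} measure"
  assumes lc: "locally_compact_space (euclidean :: 'g topology)" and haar: "haar_measure \<mu>"
    and N: "N \<in> null_sets \<mu>"
  shows "uminus ` N \<in> null_sets \<mu>"
proof -
  have "{k\<in>UNIV. - k \<in> N} \<in> null_sets \<mu>"
  proof (rule antihom_preimage_null[OF lc lc haar haar _ _ _ _ open_UNIV _ _ N])
    show "heap_antihom UNIV (uminus :: 'g \<Rightarrow> 'g)"
      by (simp only: heap_antihom_def group_normalize ball_simps simp_thms)
    show "UNIV \<subseteq> range (uminus :: 'g \<Rightarrow> 'g)" by (metis minus_minus rangeI subsetI)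
  qed (auto simp: heap_closed_def intro: continuous_intros)
  moreover have "{k\<in>UNIV. - k \<in> N} = uminus ` N" by force
  ultimately show ?thesis by simp
qed

text \<open>
  Composing \<open>f\<close> with inversion turns it into an order-reversing map, and inversion preserves null
  sets.
\<close>

lemma hom_preimage_null:
  fixes \<mu> :: "'g::{topological_group_add, second_countable_topology, t2_space} measure"
    and \<nu> :: "'f::{topological_group_add, second_countable_topology, t2_space} measure"
  assumes lc: "locally_compact_space (euclidean :: 'g topology)"
      "locally_compact_space (euclidean :: 'f topology)"
    and haar: "haar_measure \<mu>" "haar_measure \<nu>"
    and C: "open C" "heap_closed C" and f: "continuous_on C f" "heap_hom C f"
    and U: "open U" "U \<noteq> {}" "U \<subseteq> f ` C"
    and N: "N \<in> null_sets \<nu>"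
  shows "{k\<in>C. f k \<in> N} \<in> null_sets \<mu>"
proof -
  define D where "D = uminus -` C"
  have "{k\<in>D. f (- k) \<in> N} \<in> null_sets \<mu>"
  proof (rule antihom_preimage_null[OF lc haar _ _ _ _ U(1,2) _ N])
    show "open D" unfolding D_def by (intro open_vimage C continuous_intros)
    have neg: "- (x - y + z) = - z - - y + - x" for x y z :: 'g
      by (simp only: group_normalize)
    show "heap_closed D" using C(2) unfolding heap_closed_def D_def vimage_eq neg by blast
    show "heap_antihom D (\<lambda>k. f (- k))" 
      using f(2) unfolding heap_antihom_def heap_hom_def D_def vimage_eq neg by blast
    show "continuous_on D (\<lambda>k. f (- k))"
      by (intro continuous_on_compose2[OF f(1)] continuous_intros) (auto simp: D_def)
    show "U \<subseteq> (\<lambda>k. f (- k)) ` D"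
      using U(3) unfolding D_def by (force simp: image_iff intro: bexI[of _ "- x" for x])
  qed
  from inversion_null[OF lc(1) haar(1) this]
  have "uminus ` {k \<in> D. f (- k) \<in> N} \<in> null_sets \<mu>" .
  moreover have "uminus ` {k \<in> D. f (- k) \<in> N} = {k\<in>C. f k \<in> N}"
  proof (rule set_eqI)
    fix k show "k \<in> uminus ` {k \<in> D. f (- k) \<in> N} \<longleftrightarrow> k \<in> {k\<in>C. f k \<in> N}"
      by (auto simp: D_def image_iff intro!: exI[of _ "- k"])
  qed
  ultimately show ?thesis by simp
qed

section \<open>Differences of sets of positive measure and open maps\<close>

text \<open>
  Outer regularity gives an open \<open>U \<supseteq> A\<close> of measure less than twice that of \<open>A\<close>, and compactness
  gives a neighbourhood \<open>B\<close> of the identity with \<open>B + A \<subseteq> U\<close>.  For \<open>s \<in> B\<close> the set \<open>U\<close> is too small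
  to contain disjoint copies \<open>s + A\<close> and \<open>A\<close>.
\<close>

lemma steinhaus:
  fixes \<nu> :: "'f::{topological_group_add, second_countable_topology, t2_space} measure"
  assumes haar: "haar_measure \<nu>" and A: "compact A" "emeasure \<nu> A > 0"
  obtains B where "open B" "0 \<in> B" "\<And>s. s \<in> B \<Longrightarrow> \<exists>a\<in>A. \<exists>b\<in>A. s = a - b"
proof -
  have A_meas: "A \<in> sets borel" using A by (simp add: compact_imp_closed)
  have fin: "emeasure \<nu> A < \<infinity>" by (rule haar_compact_finite[OF haar A(1)])
  have "emeasure \<nu> A < emeasure \<nu> A + emeasure \<nu> A"
    using A(2) fin by (simp add: ennreal_add_left_cancel_less)
  moreover have "emeasure \<nu> A = (INF U\<in>{U. open U \<and> A \<subseteq> U}. emeasure \<nu> U)"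
    using haar A_meas by (simp add: haar_measure_def)
  ultimately have "(INF U\<in>{U. open U \<and> A \<subseteq> U}. emeasure \<nu> U) < emeasure \<nu> A + emeasure \<nu> A"
    by simp
  then obtain U where U: "open U" "A \<subseteq> U" "emeasure \<nu> U < emeasure \<nu> A + emeasure \<nu> A"
    unfolding INF_less_iff by auto
  define W where "W = (\<lambda>p. fst p + snd p) -` U"
  have W: "open W" unfolding W_def by (intro open_vimage U continuous_intros)
  have "{0} \<times> A \<subseteq> W" using U(2) by (auto simp: W_def)
  from Elementary_Topology.tube_lemma[OF A(1) W this]
  obtain B where B: "0 \<in> B" "open B" "B \<times> A \<subseteq> W" by auto
  show thesis
  proof (rule that[OF B(2,1)])
    fix s assume s: "s \<in> B"
    have sA: "(+) s ` A \<in> sets borel"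
      by (intro borel_closed compact_imp_closed compact_continuous_image A continuous_intros)
    have "(+) s ` A \<inter> A \<noteq> {}"
    proof
      assume "(+) s ` A \<inter> A = {}"
      then have "emeasure \<nu> A + emeasure \<nu> A = emeasure \<nu> ((+) s ` A \<union> A)"
        using plus_emeasure[of "(+) s ` A" \<nu> A] sA A_meas haar_translation[OF haar A_meas]
        by (simp add: haar_sets[OF haar])
      also have "\<dots> \<le> emeasure \<nu> U"
        using B(3) s U by (intro emeasure_mono) (auto simp: W_def haar_sets[OF haar])
      finally show False using U(3) by simp
    qed
    then obtain a b where ab: "a \<in> A" "b \<in> A" "s + b = a" by auto
    then have "s = a - b" by (simp add: eq_diff_eq)
    then show "\<exists>a\<in>A. \<exists>b\<in>A. s = a - b" using ab by blast
  qed
qed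

text \<open>
  Around \<open>t \<in> U\<close> there is a compact neighbourhood \<open>K\<close> of \<open>t\<close> so small that \<open>v - v' + t\<close> and
  \<open>t - v' + v\<close> lie in \<open>U\<close> for all \<open>v, v' \<in> K\<close>.  One of these two points, according to whether \<open>f\<close>
  preserves or reverses the heap operation, is mapped to \<open>f v - f v' + f t\<close>.  The values
  \<open>f v - f v'\<close> fill a neighbourhood of the identity by Steinhaus' theorem for \<open>f ` K\<close>.
\<close>

lemma heap_map_open:
  fixes f :: "'g::{topological_group_add, second_countable_topology, t2_space} \<Rightarrow>
              'f::{topological_group_add, second_countable_topology, t2_space}"
  assumes lc: "locally_compact_space (euclidean :: 'g topology)"
    and haar: "haar_measure \<nu>"
    and f: "continuous_on C f" "heap_hom C f \<or> heap_antihom C f"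
    and Y: "Y \<subseteq> C"
    and pos: "\<And>K. compact K \<Longrightarrow> interior K \<noteq> {} \<Longrightarrow> K \<subseteq> Y \<Longrightarrow> emeasure \<nu> (f ` K) > 0"
    and U: "open U" "U \<subseteq> Y"
  shows "open (f ` U)"
proof (subst open_subopen, intro ballI)
  fix y assume "y \<in> f ` U"
  then obtain t where t: "t \<in> U" "y = f t" by auto
  define W where "W = (\<lambda>p. fst p - snd p + t) -` U \<inter> (\<lambda>p. t - snd p + fst p) -` U"
  have "open W" unfolding W_def by (intro open_Int open_vimage U continuous_intros)
  moreover have "(t, t) \<in> W" using t by (simp add: W_def)
  ultimately obtain O1 O2 where "open O1" "open O2" "(t, t) \<in> O1 \<times> O2" and O12': "O1 \<times> O2 \<subseteq> W"
    by (rule open_prod_elim)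
  then have O12: "open (O1 \<inter> O2 \<inter> U)" "t \<in> O1 \<inter> O2 \<inter> U" using U t by auto
  obtain V K where V: "open V" "compact K" "t \<in> V" "V \<subseteq> K" "K \<subseteq> O1 \<inter> O2 \<inter> U"
    by (rule locally_compact_nbhd[OF lc O12])
  have K: "v - v' + t \<in> U" "t - v' + v \<in> U" if "v \<in> K" "v' \<in> K" for v v'
    proof -
    have "(v, v') \<in> O1 \<times> O2" using that V(5) by blast
    then have "(v, v') \<in> W" using O12' by blast
    then show "v - v' + t \<in> U" "t - v' + v \<in> U" by (simp_all add: W_def)
  qed
  have "t \<in> interior K" using V by (meson interior_maximal subsetD)
  then have "interior K \<noteq> {}" by blast
  moreover have KY: "K \<subseteq> Y" "K \<subseteq> C" using V U Y by auto
  ultimately have fK: "emeasure \<nu> (f ` K) > 0" using pos V(2) by blast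
  have cK: "compact (f ` K)"
    using V(2) continuous_on_subset[OF f(1) KY(2)] by (rule compact_continuous_image[rotated])
  obtain B where B: "open B" "0 \<in> B" "\<And>s. s \<in> B \<Longrightarrow> \<exists>a\<in>f ` K. \<exists>b\<in>f ` K. s = a - b"
    by (rule steinhaus[OF haar cK fK]) blast
  define T where "T = (\<lambda>y. y - f t) -` B"
  have "open T" unfolding T_def by (intro open_vimage B continuous_intros)
  moreover have "y \<in> T" using B t by (simp add: T_def)
  moreover have "T \<subseteq> f ` U"
  proof
    fix z assume "z \<in> T"
    then obtain v v' where v: "v \<in> K" "v' \<in> K" "z - f t = f v - f v'"
      using B(3)[of "z - f t"] by (auto simp: T_def)
    then have z: "z = f v - f v' + f t" by (metis diff_add_cancel)
    have mem: "t \<in> C" "v \<in> C" "v' \<in> C" using v KY t U Y by auto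
    from f(2) have "z = f (v - v' + t) \<or> z = f (t - v' + v)"
      using mem unfolding z heap_hom_def heap_antihom_def by auto
    then show "z \<in> f ` U" using K[OF v(1,2)] by blast
  qed
  ultimately show "\<exists>T. open T \<and> y \<in> T \<and> T \<subseteq> f ` U" by blast
qed

section \<open>The weak-star topology\<close>

lemma bounded_in_Linf:
  assumes "f \<in> borel_measurable M" "\<And>x. cmod (f x) \<le> c"
  shows "f \<in> Linf M"
proof -
  have "esssup M (\<lambda>x. ereal (cmod (f x))) \<le> ereal c"
    using assms by (intro esssup_I) auto
  then show ?thesis using assms(1) by (auto simp: Linf_def Linf_norm_def)
qed

lemma wstar_functional_continuous:
  assumes "h \<in> L1 M"
  shows "continuous_map (wstar_topology M) euclidean (\<lambda>f. \<integral>x. f x * h x \<partial>M)"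
proof -
  have "continuous_map (wstar_topology M) euclidean
      ((\<lambda>\<phi>. \<phi> h) \<circ> (\<lambda>f. \<lambda>h\<in>L1 M. \<integral>x. f x * h x \<partial>M))"
    unfolding wstar_topology_def
    by (intro continuous_map_pullback continuous_map_product_projection assms)
  then show ?thesis using assms by (simp add: o_def)
qed

lemma wstar_topspace: "topspace (wstar_topology M) = Linf M"
  by (auto simp: wstar_topology_def topspace_pullback_topology)

text \<open>
  The sequential form of the definition; it is how dominated convergence enters.
\<close>

lemma wstar_limitin:
  assumes u: "\<And>n. u n \<in> Linf M" and l: "l \<in> Linf M"
    and lim: "\<And>h. h \<in> L1 M \<Longrightarrow> (\<lambda>n. \<integral>x. u n x * h x \<partial>M) \<longlonglongrightarrow> (\<integral>x. l x * h x \<partial>M)"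
  shows "limitin (wstar_topology M) u l sequentially"
proof -
  let ?J = "\<lambda>f. \<lambda>h\<in>L1 M. \<integral>x. f x * h x \<partial>M"
  have J: "limitin (product_topology (\<lambda>_. euclidean) (L1 M)) (\<lambda>n. ?J (u n)) (?J l) sequentially"
    unfolding limitin_componentwise using lim by auto
  show ?thesis
    unfolding limitin_def
  proof (intro conjI allI impI)
    show "l \<in> topspace (wstar_topology M)" using l by (simp add: wstar_topspace)
    fix V assume V: "openin (wstar_topology M) V \<and> l \<in> V"
    then obtain U where U: "openin (product_topology (\<lambda>_. euclidean) (L1 M)) U" "V = ?J -` U \<inter> Linf M"
      by (auto simp: wstar_topology_def openin_pullback_topology)
    then have "?J l \<in> U" using V by auto
    then have "\<forall>\<^sub>F n in sequentially. ?J (u n) \<in> U" using J U(1) unfolding limitin_def by blast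
    then show "\<forall>\<^sub>F n in sequentially. u n \<in> V" by eventually_elim (use u U(2) in auto)
  qed
qed

section \<open>Functions in the Fourier algebra that are one on a compact set\<close>

text \<open>
  The function is the coefficient of the indicators of \<open>W\<close> and of the product \<open>P\<close> of \<open>Q\<close> and \<open>W\<close>,
  divided by the measure of \<open>W\<close>; its value at \<open>s\<close> is the proportion of \<open>s + W\<close> that lies in \<open>P\<close>.
  This is all of \<open>s + W\<close> if \<open>s \<in> Q\<close>, and nothing unless \<open>s + w - w' \<in> Q\<close> for some \<open>w, w' \<in> W\<close>.
\<close>

lemma fourier_algebra_bump:
  fixes \<nu> :: "'f::{topological_group_add, second_countable_topology, t2_space} measure"
  assumes lc: "locally_compact_space (euclidean :: 'f topology)" and haar: "haar_measure \<nu>"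
    and W: "open W" "0 \<in> W" "W \<subseteq> K" "compact K" and Q: "compact Q"
  obtains u where "u \<in> fourier_algebra \<nu>" "u \<in> borel_measurable \<nu>" "\<And>s. cmod (u s) \<le> 1"
    "\<And>s. s \<in> Q \<Longrightarrow> u s = 1"
    "\<And>s. (\<And>w w'. w \<in> W \<Longrightarrow> w' \<in> W \<Longrightarrow> s + w - w' \<notin> Q) \<Longrightarrow> u s = 0"
proof -
  interpret sigma_finite_measure \<nu> by (rule haar_sigma_finite[OF haar lc])
  note sets = haar_sets[OF haar]
  define P where "P = (\<Union>q\<in>Q. (+) q ` W)"
  have "open P" unfolding P_def by (intro open_UN ballI open_translation W)
  have finite_sub: "emeasure \<nu> A < \<infinity>" if "A \<subseteq> B" "compact B" for A B
    using emeasure_mono[OF that(1), of \<nu>] haar_compact_finite[OF haar that(2)] that(2)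
    by (auto simp: sets compact_imp_closed intro: le_less_trans)
  have W_fin: "emeasure \<nu> W < \<infinity>" by (rule finite_sub[OF W(3,4)])
  have "compact ((\<lambda>p. fst p + snd p) ` (Q \<times> K))"
    by (intro compact_continuous_image compact_Times Q W continuous_intros)
  moreover have "P \<subseteq> (\<lambda>p. fst p + snd p) ` (Q \<times> K)" using W(3) by (force simp: P_def)
  ultimately have P_fin: "emeasure \<nu> P < \<infinity>" by (rule finite_sub[rotated])
  define c where "c = measure \<nu> W"
  have c: "c > 0"
    using haar_open_pos[OF haar W(1)] W(2) W_fin
    by (auto simp: c_def measure_def enn2real_positive_iff)
  define \<xi> where "\<xi> = (\<lambda>t. indicator W t / complex_of_real c)"
  define \<eta> where "\<eta> = (indicator P :: 'f \<Rightarrow> complex)"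
  define u where "u = (\<lambda>s. \<integral>t. left_regular s \<xi> t * cnj (\<eta> t) \<partial>\<nu>)"
  have [measurable]: "W \<in> sets \<nu>" "P \<in> sets \<nu>" using W \<open>open P\<close> by (simp_all add: sets)
  have \<xi>: "\<xi> \<in> borel_measurable \<nu>" and \<eta>: "\<eta> \<in> borel_measurable \<nu>"
    unfolding \<xi>_def \<eta>_def by measurable
  have cnj_\<eta>: "cnj (\<eta> t) = \<eta> t" for t by (simp add: \<eta>_def indicator_def)
  have "\<xi> \<in> L2 \<nu>"
  proof -
    have "integrable \<nu> (\<lambda>x. indicator W x / c\<^sup>2 :: real)"
      using W_fin by (intro integrable_divide_zero integrable_real_indicator) auto
    moreover have "(\<lambda>x. (cmod (\<xi> x))\<^sup>2) = (\<lambda>x. indicator W x / c\<^sup>2)"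
      by (auto simp: \<xi>_def indicator_def norm_divide power_divide)
    ultimately show ?thesis using \<xi> by (simp add: L2_def)
  qed
  moreover have "\<eta> \<in> L2 \<nu>"
  proof -
    have "integrable \<nu> (indicator P :: 'f \<Rightarrow> real)"
      using P_fin by (intro integrable_real_indicator) auto
    moreover have "(\<lambda>x. (cmod (\<eta> x))\<^sup>2) = indicator P"
      by (auto simp: \<eta>_def indicator_def)
    ultimately show ?thesis using \<eta> by (simp add: L2_def)
  qed
  ultimately have "u \<in> fourier_algebra \<nu>" unfolding u_def fourier_algebra_def by blast
  have u_eq: "u s = complex_of_real (measure \<nu> ((+) s ` W \<inter> P) / c)" for s
  proof -
    have "(\<lambda>t. left_regular s \<xi> t * cnj (\<eta> t))
        = (\<lambda>t. complex_of_real (indicator ((+) s ` W \<inter> P) t / c))"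
    proof
      fix t
      have "- s + t \<in> W \<longleftrightarrow> t \<in> (+) s ` W"
        by (auto simp: image_iff add.assoc[symmetric] intro!: bexI[of _ "- s + t"])
      then show "left_regular s \<xi> t * cnj (\<eta> t) = complex_of_real (indicator ((+) s ` W \<inter> P) t / c)"
        by (auto simp: left_regular_def \<xi>_def \<eta>_def indicator_def)
    qed
    then show ?thesis by (simp add: u_def haar_space[OF haar])
  qed
  have sW: "(+) s ` W \<in> sets \<nu>" "emeasure \<nu> ((+) s ` W) = emeasure \<nu> W" for s
    using open_translation[OF W(1), of s] haar_translation[OF haar, of W s] W(1) by (simp_all add: sets)
  have le: "measure \<nu> ((+) s ` W \<inter> P) \<le> c" for s
    unfolding c_def measure_def using sW[of s] W_fin
    by (intro enn2real_mono) (metis emeasure_mono inf_le1, simp)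
  have "u \<in> borel_measurable \<nu>"
  proof -
    have "(\<lambda>p. - fst p + snd p) \<in> borel_measurable (borel :: ('f \<times> 'f) measure)"
      by (intro borel_measurable_continuous_onI continuous_intros)
    then have 1: "(\<lambda>p. - fst p + snd p) \<in> measurable (\<nu> \<Otimes>\<^sub>M \<nu>) \<nu>"
      unfolding borel_prod[symmetric]
      using measurable_cong_sets[OF sets_pair_measure_cong[OF sets sets] sets] by blast
    have "(\<lambda>p. \<xi> (- fst p + snd p) * cnj (\<eta> (snd p))) \<in> borel_measurable (\<nu> \<Otimes>\<^sub>M \<nu>)"
      using measurable_compose[OF 1 \<xi>] measurable_compose[OF measurable_snd \<eta>] unfolding cnj_\<eta>
      by (intro borel_measurable_times)
    then show ?thesis
      unfolding u_def left_regular_def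
      by (intro borel_measurable_lebesgue_integral) (simp add: case_prod_unfold)
  qed
  moreover have "cmod (u s) \<le> 1" for s
    using c le[of s] by (simp add: u_eq norm_divide)
  moreover have "u s = 1" if "s \<in> Q" for s
  proof -
    have "(+) s ` W \<inter> P = (+) s ` W" using that by (auto simp: P_def)
    then have "measure \<nu> ((+) s ` W \<inter> P) = c" using sW(2) by (simp add: c_def measure_def)
    then show ?thesis using c by (simp add: u_eq)
  qed
  moreover have "u s = 0" if s: "\<And>w w'. w \<in> W \<Longrightarrow> w' \<in> W \<Longrightarrow> s + w - w' \<notin> Q" for s
  proof -
    have "(+) s ` W \<inter> P = {}"
    proof (rule ccontr)
      assume "(+) s ` W \<inter> P \<noteq> {}"
      then obtain w q w' where "w \<in> W" "w' \<in> W" "q \<in> Q" "s + w = q + w'" by (auto simp: P_def)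
      then show False using s[of w w'] by simp
    qed
    then show ?thesis by (simp add: u_eq)
  qed
  ultimately show thesis using that \<open>u \<in> fourier_algebra \<nu>\<close> by blast
qed

text \<open>
  The bumps for a sequence of neighbourhoods shrinking to the identity: as \<open>Q\<close> is closed, a point \<open>s\<close>
  outside it satisfies \<open>s + w - w' \<notin> Q\<close> for all \<open>w, w'\<close> close to the identity.
\<close>

lemma fourier_algebra_approximates_indicator:
  fixes \<nu> :: "'f::{topological_group_add, second_countable_topology, t2_space} measure"
  assumes lc: "locally_compact_space (euclidean :: 'f topology)" and haar: "haar_measure \<nu>"
    and Q: "compact Q"
  obtains u where "\<And>n::nat. u n \<in> fourier_algebra \<nu>" "\<And>n. u n \<in> borel_measurable \<nu>"
    "\<And>n s. cmod (u n s) \<le> 1" "\<And>n s. s \<in> Q \<Longrightarrow> u n s = 1"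
    "\<And>s. s \<notin> Q \<Longrightarrow> (\<lambda>n. u n s) \<longlonglongrightarrow> 0"
proof -
  obtain W0 K where W0: "open W0" "compact K" "(0::'f) \<in> W0" "W0 \<subseteq> K"
    by (rule locally_compact_nbhd[OF lc open_UNIV UNIV_I])
  obtain A where A: "\<And>n::nat. open (A n)" "\<And>n. (0::'f) \<in> A n"
    "\<And>S. open S \<Longrightarrow> 0 \<in> S \<Longrightarrow> \<forall>\<^sub>F n in sequentially. A n \<subseteq> S"
    by (rule countable_basis_at_decseq[of "0::'f"]) blast
  have "\<exists>u. u \<in> fourier_algebra \<nu> \<and> u \<in> borel_measurable \<nu> \<and> (\<forall>s. cmod (u s) \<le> 1) \<and>
      (\<forall>s\<in>Q. u s = 1) \<and>
      (\<forall>s. (\<forall>w\<in>A n \<inter> W0. \<forall>w'\<in>A n \<inter> W0. s + w - w' \<notin> Q) \<longrightarrow> u s = 0)" for n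
  proof -
    have "open (A n \<inter> W0)" "0 \<in> A n \<inter> W0" "A n \<inter> W0 \<subseteq> K" using W0 A by auto
    from fourier_algebra_bump[OF lc haar this W0(2) Q]
    obtain u where "u \<in> fourier_algebra \<nu>" "u \<in> borel_measurable \<nu>" "\<And>s. cmod (u s) \<le> 1"
      "\<And>s. s \<in> Q \<Longrightarrow> u s = 1"
      "\<And>s. (\<And>w w'. w \<in> A n \<inter> W0 \<Longrightarrow> w' \<in> A n \<inter> W0 \<Longrightarrow> s + w - w' \<notin> Q) \<Longrightarrow> u s = 0"
      by blast
    then show ?thesis by (intro exI[of _ u]) simp
  qed
  then obtain u where u: "\<And>n. u n \<in> fourier_algebra \<nu>" "\<And>n. u n \<in> borel_measurable \<nu>"
    "\<And>n s. cmod (u n s) \<le> 1" "\<And>n s. s \<in> Q \<Longrightarrow> u n s = 1"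
    "\<And>n s. \<forall>w\<in>A n \<inter> W0. \<forall>w'\<in>A n \<inter> W0. s + w - w' \<notin> Q \<Longrightarrow> u n s = 0"
    by metis
  have "(\<lambda>n. u n s) \<longlonglongrightarrow> 0" if s: "s \<notin> Q" for s
  proof (rule tendsto_eventually)
    define T where "T = (\<lambda>p. s + fst p - snd p) -` (- Q)"
    have "open T" unfolding T_def
      using compact_imp_closed[OF Q] by (intro open_vimage continuous_intros) auto
    moreover have "(0, 0) \<in> T" using s by (simp add: T_def)
    ultimately obtain B1 B2 where B: "open B1" "open B2" "(0, 0) \<in> B1 \<times> B2" "B1 \<times> B2 \<subseteq> T"
      by (rule open_prod_elim)
    have "\<forall>\<^sub>F n in sequentially. A n \<subseteq> B1 \<inter> B2" using B by (intro A(3)) auto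
    then show "\<forall>\<^sub>F n in sequentially. u n s = 0"
    proof eventually_elim
      case (elim n)
      have "s + w - w' \<notin> Q" if "w \<in> A n \<inter> W0" "w' \<in> A n \<inter> W0" for w w'
      proof -
        have "(w, w') \<in> T" using that elim B(4) by blast
        then show ?thesis by (simp add: T_def)
      qed
      then show ?case by (intro u(5)) blast
    qed
  qed
  with u show thesis by (intro that[of u]) 
qed

section \<open>Extensions detect null images\<close>

text \<open>
  Take a bounded sequence of functions \<open>u n\<close> of the Fourier algebra that are one on \<open>\<alpha> ` K\<close> and
  converge pointwise to its indicator.  If \<open>\<alpha> ` K\<close> were null, they would tend to zero almost
  everywhere, hence weak-star by dominated convergence, and so would \<open>\<Phi> (u n)\<close>.  But \<open>\<Phi> (u n)\<close> equals one on \<open>K\<close>, so its integral against the indicator of \<open>K\<close> is the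
  measure of \<open>K\<close> for every \<open>n\<close>.
\<close>

lemma extension_image_not_null:
  fixes \<mu> :: "'g::{topological_group_add, second_countable_topology, t2_space} measure"
    and \<nu> :: "'f::{topological_group_add, second_countable_topology, t2_space} measure"
  assumes lc: "locally_compact_space (euclidean :: 'f topology)"
    and haar: "haar_measure \<mu>" "haar_measure \<nu>"
    and ext: "extends_to_wstar_hom \<nu> \<mu> (induced_map Y \<alpha>)"
    and K: "compact K" "K \<subseteq> Y" "continuous_on K \<alpha>" "emeasure \<mu> K > 0"
  shows "emeasure \<nu> (\<alpha> ` K) > 0"
proof (rule ccontr)
  assume "\<not> ?thesis"
  then have null: "emeasure \<nu> (\<alpha> ` K) = 0" by simp
  have Q: "compact (\<alpha> ` K)" by (rule compact_continuous_image[OF K(3,1)])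
  then have Q_null: "\<alpha> ` K \<in> null_sets \<nu>"
    using null by (simp add: null_sets_def haar_sets[OF haar(2)] compact_imp_closed)
  have K_meas[measurable]: "K \<in> sets \<mu>" using K(1) by (simp add: haar_sets[OF haar(1)] compact_imp_closed)
  have K_fin: "emeasure \<mu> K < \<infinity>" by (rule haar_compact_finite[OF haar(1) K(1)])
  obtain \<Phi> where hom: "Linf_hom \<nu> \<mu> \<Phi>" and cont: "continuous_map (wstar_topology \<nu>) (wstar_topology \<mu>) \<Phi>"
    and ext: "\<And>u. u \<in> fourier_algebra \<nu> \<Longrightarrow> AE t in \<mu>. \<Phi> u t = induced_map Y \<alpha> u t"
    using ext unfolding extends_to_wstar_hom_def by blast
  obtain u where u: "\<And>n::nat. u n \<in> fourier_algebra \<nu>" "\<And>n. u n \<in> borel_measurable \<nu>"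
    "\<And>n s. cmod (u n s) \<le> 1" "\<And>n s. s \<in> \<alpha> ` K \<Longrightarrow> u n s = 1"
    "\<And>s. s \<notin> \<alpha> ` K \<Longrightarrow> (\<lambda>n. u n s) \<longlonglongrightarrow> 0"
    by (rule fourier_algebra_approximates_indicator[OF lc haar(2) Q]) blast
  have u_Linf: "u n \<in> Linf \<nu>" for n by (rule bounded_in_Linf[OF u(2,3)])
  have z_Linf: "(\<lambda>_. 0) \<in> Linf \<nu>" by (rule bounded_in_Linf[where c = 0]) auto
  have "limitin (wstar_topology \<nu>) u (\<lambda>_. 0) sequentially"
  proof (rule wstar_limitin[OF u_Linf z_Linf])
    fix h assume "h \<in> L1 \<nu>"
    then have h: "integrable \<nu> h" by (simp add: L1_def)
    have "AE x in \<nu>. x \<notin> \<alpha> ` K" by (rule AE_not_in[OF Q_null])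
    then have ae: "AE x in \<nu>. (\<lambda>n. u n x * h x) \<longlonglongrightarrow> 0 * h x"
      by eventually_elim (intro tendsto_mult tendsto_const u(5))
    show "(\<lambda>n. \<integral>x. u n x * h x \<partial>\<nu>) \<longlonglongrightarrow> (\<integral>x. 0 * h x \<partial>\<nu>)"
    proof (rule integral_dominated_convergence[OF _ _ _ ae])
      show "integrable \<nu> (\<lambda>x. norm (h x))" using h by simp
      show "(\<lambda>x. u n x * h x) \<in> borel_measurable \<nu>" for n
        using u(2) h by (intro borel_measurable_times) auto
      show "AE x in \<nu>. norm (u n x * h x) \<le> norm (h x)" for n
        using u(3) by (intro AE_I2) (simp add: norm_mult mult_left_le_one_le)
    qed simp
  qed
  from continuous_map_limit[OF cont this]
  have lim: "limitin (wstar_topology \<mu>) (\<Phi> \<circ> u) (\<Phi> (\<lambda>_. 0)) sequentially" .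
  define h :: "'g \<Rightarrow> complex" where "h = (\<lambda>x. complex_of_real (indicator K x))"
  have h: "h \<in> L1 \<mu>" using K_fin unfolding L1_def h_def by (auto intro!: integrable_of_real integrable_real_indicator)
  from continuous_map_limit[OF wstar_functional_continuous[OF h] lim]
  have "(\<lambda>n. \<integral>x. \<Phi> (u n) x * h x \<partial>\<mu>) \<longlonglongrightarrow> (\<integral>x. \<Phi> (\<lambda>_. 0) x * h x \<partial>\<mu>)"
    by (simp add: o_def)
  moreover have "(\<integral>x. \<Phi> (u n) x * h x \<partial>\<mu>) = measure \<mu> K" for n
  proof -
    have "(\<integral>x. \<Phi> (u n) x * h x \<partial>\<mu>) = (\<integral>x. h x \<partial>\<mu>)"
    proof (rule integral_cong_AE)
      have Phi: "\<Phi> (u n) \<in> borel_measurable \<mu>"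
        using hom u_Linf[of n] by (auto simp: Linf_hom_def Linf_def)
      show "(\<lambda>x. \<Phi> (u n) x * h x) \<in> borel_measurable \<mu>"
        using Phi unfolding h_def by measurable
      show "h \<in> borel_measurable \<mu>" unfolding h_def by measurable
      show "AE x in \<mu>. \<Phi> (u n) x * h x = h x"
        using ext[OF u(1)[of n]]
      proof eventually_elim
        case (elim x)
        then show ?case using K(2) u(4)[of "\<alpha> x" n] by (auto simp: h_def indicator_def induced_map_def)
      qed
    qed
    also have "\<dots> = measure \<mu> K" by (simp add: h_def haar_space[OF haar(1)])
    finally show ?thesis .
  qed
  moreover have "(\<integral>x. \<Phi> (\<lambda>_. 0) x * h x \<partial>\<mu>) = 0"
  proof -
    have "\<forall>c. \<forall>f\<in>Linf \<nu>. AE y in \<mu>. \<Phi> (\<lambda>x. c * f x) y = c * \<Phi> f y"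
      using hom unfolding Linf_hom_def by (elim conjE) assumption
    from bspec[OF spec[OF this, of 0] z_Linf]
    have "AE y in \<mu>. \<Phi> (\<lambda>_. 0) y * h y = 0" by (auto elim: eventually_mono)
    then show ?thesis by (rule integral_eq_zero_AE)
  qed
  ultimately have "measure \<mu> K = 0" by (simp add: LIMSEQ_const_iff)
  then show False using K(4) K_fin by (auto simp: measure_def enn2real_eq_0_iff)
qed

section \<open>Composition with a nonsingular map\<close>

lemma Linf_AE_bound:
  assumes "f \<in> Linf M"
  obtains C where "AE x in M. cmod (f x) \<le> C"
proof -
  have ae: "AE x in M. ereal (cmod (f x)) \<le> Linf_norm M f"
    unfolding Linf_norm_def by (rule esssup_AE)
  have "\<exists>C::real. Linf_norm M f \<le> ereal C"
    using assms by (cases "Linf_norm M f") (auto simp: Linf_def intro: exI[of _ 0])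
  then obtain C :: real where C: "Linf_norm M f \<le> ereal C" ..
  have "AE x in M. cmod (f x) \<le> C"
    using ae
  proof eventually_elim
    case (elim x)
    then have "ereal (cmod (f x)) \<le> ereal C" using C by (rule order_trans)
    then show ?case by simp
  qed
  then show thesis by (rule that)
qed

lemma Linf_times_L1_integrable:
  assumes f: "f \<in> Linf M" and h: "h \<in> L1 M"
  shows "integrable M (\<lambda>x. f x * h x)"
proof -
  obtain C where C: "AE x in M. cmod (f x) \<le> C" by (rule Linf_AE_bound[OF f])
  have h': "integrable M h" using h by (simp add: L1_def)
  have meas: "(\<lambda>x. f x * h x) \<in> borel_measurable M"
    using f h' by (intro borel_measurable_times) (auto simp: Linf_def)
  have "integrable M (\<lambda>x. C * norm (h x))" using h' by simp
  then show ?thesis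
  proof (rule Bochner_Integration.integrable_bound[OF _ meas])
    show "AE x in M. norm (f x * h x) \<le> norm (C * norm (h x))"
      using C
    proof eventually_elim
      case (elim x)
      then have "cmod (f x) * cmod (h x) \<le> C * cmod (h x)" by (rule mult_right_mono) simp
      then show ?case by (simp add: norm_mult)
    qed
  qed
qed

text \<open>
  These maps, under which preimages of null sets are null, are the ones with which classes of
  functions modulo null sets can be composed.
\<close>

locale nonsingular_partial_map =
  fixes \<mu> :: "'a measure" and \<nu> :: "'b measure" and Y :: "'a set" and \<alpha> :: "'a \<Rightarrow> 'b"
  assumes sigma_finite: "sigma_finite_measure \<nu>"
    and nonzero: "emeasure \<nu> (space \<nu>) \<noteq> 0"
    and domain: "Y \<in> sets \<mu>"
    and measurable_map: "\<alpha> \<in> measurable (restrict_space \<mu> Y) \<nu>"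
    and nonsingular: "\<And>N. N \<in> null_sets \<nu> \<Longrightarrow> {t\<in>Y. \<alpha> t \<in> N} \<in> null_sets \<mu>"
begin

lemma AE_transfer:
  assumes "AE x in \<nu>. P x"
  shows "AE t in \<mu>. t \<in> Y \<longrightarrow> P (\<alpha> t)"
proof -
  obtain N where N: "{x\<in>space \<nu>. \<not> P x} \<subseteq> N" "emeasure \<nu> N = 0" "N \<in> sets \<nu>"
    using AE_E[OF assms] by blast
  have "\<alpha> t \<in> space \<nu>" if "t \<in> Y" for t
    using that measurable_space[OF measurable_map, of t] sets.sets_into_space[OF domain]
    by (auto simp: space_restrict_space)
  then show ?thesis
    using N by (intro AE_I'[OF nonsingular[of N]]) (auto simp: null_sets_def)
qed

lemma induced_eq: "induced_map Y \<alpha> f = (\<lambda>t. indicator Y t *\<^sub>R f (\<alpha> t))"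
  by (auto simp: induced_map_def indicator_def)

lemma induced_measurable:
  assumes "f \<in> borel_measurable \<nu>"
  shows "induced_map Y \<alpha> f \<in> borel_measurable \<mu>"
  using measurable_compose[OF measurable_map assms] domain
  by (simp add: induced_eq borel_measurable_restrict_space_iff)

text \<open>
  Off \<open>Y\<close> the induced function is zero, so the bound must also be nonnegative.  It is, because \<open>\<nu>\<close> is
  nonzero; over the zero measure the essential supremum of a measurable function is \<open>-\<infinity>\<close>.
\<close>

lemma Linf_norm_induced:
  assumes "f \<in> borel_measurable \<nu>"
  shows "Linf_norm \<mu> (induced_map Y \<alpha> f) \<le> Linf_norm \<nu> f"
proof -
  have ae: "AE x in \<nu>. ereal (cmod (f x)) \<le> Linf_norm \<nu> f"
    unfolding Linf_norm_def by (rule esssup_AE)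
  have "\<not> (AE x in \<nu>. False)"
    using nonzero by (simp add: AE_iff_null null_sets_def)
  moreover have "AE x in \<nu>. False" if "\<not> 0 \<le> Linf_norm \<nu> f"
    using ae
  proof eventually_elim
    case (elim x)
    have "0 \<le> ereal (cmod (f x))" by simp
    then show ?case using elim that order_trans by blast
  qed
  ultimately have "0 \<le> Linf_norm \<nu> f" by blast
  note nonneg = this
  have "AE t in \<mu>. ereal (cmod (induced_map Y \<alpha> f t)) \<le> Linf_norm \<nu> f"
    using AE_transfer[OF ae]
  proof (eventually_elim)
    case (elim t)
    then show ?case using nonneg by (cases "t \<in> Y") (simp_all add: induced_map_def flip: zero_ereal_def)
  qed
  then show ?thesis
    unfolding Linf_norm_def[of \<mu>] using induced_measurable[OF assms] by (intro esssup_I) auto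
qed

lemma induced_Linf: "f \<in> Linf \<nu> \<Longrightarrow> induced_map Y \<alpha> f \<in> Linf \<mu>"
  unfolding Linf_def using induced_measurable[of f] le_less_trans[OF Linf_norm_induced[of f]] by blast

lemma induced_hom: "Linf_hom \<nu> \<mu> (induced_map Y \<alpha>)"
  unfolding Linf_hom_def
proof (intro conjI ballI allI impI)
  fix f g :: "'b \<Rightarrow> complex" assume "AE x in \<nu>. f x = g x"
  from AE_transfer[OF this] show "AE t in \<mu>. induced_map Y \<alpha> f t = induced_map Y \<alpha> g t"
    by (auto simp: induced_map_def elim: eventually_mono)
qed (auto simp: induced_Linf, auto simp: induced_map_def)

lemma induced_bounded: "Linf_bounded \<nu> \<mu> (induced_map Y \<alpha>)"
  unfolding Linf_bounded_def using Linf_norm_induced by (intro exI[of _ 1]) (auto simp: Linf_def)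

text \<open>
  The image under \<open>\<alpha>\<close> of the finite measure with density \<open>h\<close> on \<open>Y\<close> is absolutely continuous, by
  nonsingularity, and \<open>D\<close> is its Radon-Nikodym derivative.
\<close>

lemma preadjoint_nonneg:
  assumes h: "integrable \<mu> h" "\<And>x. 0 \<le> (h x :: real)"
  obtains D where "integrable \<nu> D"
    "\<And>f. f \<in> borel_measurable \<nu> \<Longrightarrow>
      (\<integral>t. induced_map Y \<alpha> f t * complex_of_real (h t) \<partial>\<mu>) = (\<integral>x. f x * complex_of_real (D x) \<partial>\<nu>)"
proof -
  interpret sigma_finite_measure \<nu> by (rule sigma_finite)
  define R where "R = restrict_space \<mu> Y"
  have dom: "Y \<inter> space \<mu> \<in> sets \<mu>" using domain by simp
  have \<alpha>[measurable]: "\<alpha> \<in> measurable R \<nu>" using measurable_map by (simp add: R_def)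
  have hR: "integrable R h"
    unfolding R_def integrable_restrict_space[OF dom] using h(1) domain
    by (rule integrable_mult_indicator[rotated])
  have [measurable]: "h \<in> borel_measurable R" using hR by simp
  have \<alpha>_dens: "\<alpha> \<in> measurable (density R (\<lambda>x. ennreal (h x))) \<nu>" using \<alpha> by simp
  define N where "N = distr (density R (\<lambda>x. ennreal (h x))) \<nu> \<alpha>"
  have N_sets: "sets N = sets \<nu>" by (simp add: N_def)
  have N_eq: "emeasure N A = (\<integral>\<^sup>+x. ennreal (h x) * indicator (\<alpha> -` A \<inter> space R) x \<partial>R)"
    if "A \<in> sets \<nu>" for A
    using that \<alpha>_dens measurable_sets[OF \<alpha> that] unfolding N_def
    by (simp add: emeasure_distr emeasure_density)
  have N_fin: "emeasure N (space \<nu>) < \<infinity>"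
  proof -
    have "emeasure N (space \<nu>) \<le> (\<integral>\<^sup>+x. ennreal (h x) \<partial>R)"
      unfolding N_eq[OF sets.top] by (intro nn_integral_mono) (auto simp: indicator_def)
    also have "\<dots> < \<infinity>" using hR h(2) by (simp add: integrable_iff_bounded)
    finally show ?thesis .
  qed
  have "finite_measure N"
    using N_fin sets_eq_imp_space_eq[OF N_sets] by (intro finite_measureI) auto
  moreover have ac: "absolutely_continuous \<nu> N"
    unfolding absolutely_continuous_def
  proof
    fix A assume A: "A \<in> null_sets \<nu>"
    have "AE x in R. ennreal (h x) * indicator (\<alpha> -` A \<inter> space R) x = 0"
    proof -
      have "AE t in \<mu>. t \<in> Y \<longrightarrow> \<alpha> t \<notin> A" by (rule AE_transfer[OF AE_not_in[OF A]])
      then have "AE t in R. \<alpha> t \<notin> A" unfolding R_def AE_restrict_space_iff[OF dom] .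
      then show ?thesis by eventually_elim simp
    qed
    then have "(\<integral>\<^sup>+x. ennreal (h x) * indicator (\<alpha> -` A \<inter> space R) x \<partial>R) = (\<integral>\<^sup>+x. 0 \<partial>R)"
      by (rule nn_integral_cong_AE)
    then have "emeasure N A = 0" using N_eq[OF null_setsD2[OF A]] by simp
    then show "A \<in> null_sets N" using A N_sets by auto
  qed
  ultimately obtain D where D[measurable]: "D \<in> borel_measurable \<nu>"
    and D_eq: "AE x in \<nu>. RN_deriv \<nu> N x = ennreal (D x)" and D_pos: "\<And>x. 0 \<le> D x"
    by (rule real_RN_deriv[OF _ _ N_sets]) blast
  have dens: "density \<nu> (\<lambda>x. ennreal (D x)) = N"
  proof -
    have "density \<nu> (\<lambda>x. ennreal (D x)) = density \<nu> (RN_deriv \<nu> N)"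
      using D_eq by (intro density_cong) (auto elim: eventually_mono)
    then show ?thesis using density_RN_deriv[OF ac N_sets] by simp
  qed
  have "integrable \<nu> D"
  proof (rule integrableI_nonneg)
    have "(\<integral>\<^sup>+x. ennreal (D x) \<partial>\<nu>) = emeasure N (space \<nu>)"
      unfolding dens[symmetric] by (subst emeasure_density) (auto intro!: nn_integral_cong)
    then show "(\<integral>\<^sup>+x. ennreal (D x) \<partial>\<nu>) < \<infinity>" using N_fin by simp
  qed (auto simp: D_pos)
  moreover have "(\<integral>t. induced_map Y \<alpha> f t * complex_of_real (h t) \<partial>\<mu>) = (\<integral>x. f x * complex_of_real (D x) \<partial>\<nu>)"
    if f: "f \<in> borel_measurable \<nu>" for f
  proof -
    have "(\<integral>x. f x * complex_of_real (D x) \<partial>\<nu>) = (\<integral>x. D x *\<^sub>R f x \<partial>\<nu>)"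
      by (simp add: scaleR_conv_of_real mult.commute)
    also have "\<dots> = integral\<^sup>L N f"
      unfolding dens[symmetric] using f D_pos by (intro integral_density[symmetric]) auto
    also have "\<dots> = (\<integral>x. f (\<alpha> x) \<partial>density R (\<lambda>x. ennreal (h x)))"
      unfolding N_def by (rule integral_distr[OF \<alpha>_dens f])
    also have "\<dots> = (\<integral>x. h x *\<^sub>R f (\<alpha> x) \<partial>R)"
      using h(2) measurable_compose[OF \<alpha> f] by (intro integral_density) auto
    also have "\<dots> = (\<integral>x. indicator Y x *\<^sub>R (h x *\<^sub>R f (\<alpha> x)) \<partial>\<mu>)"
      unfolding R_def by (rule integral_restrict_space[OF dom])
    also have "\<dots> = (\<integral>t. induced_map Y \<alpha> f t * complex_of_real (h t) \<partial>\<mu>)"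
      by (intro Bochner_Integration.integral_cong refl)
        (simp add: induced_eq scaleR_conv_of_real mult_ac)
    finally show ?thesis by simp
  qed
  ultimately show thesis by (rule that)
qed

text \<open>
  The functions \<open>h\<close> at which the pre-adjoint $L^1(\mu) \to L^1(\nu)$ of the induced map is defined.
  A map with a pre-adjoint is weak-star continuous, so the aim is that these are all of $L^1(\mu)$; it is
  reached by writing \<open>h\<close> as a linear combination of nonnegative functions.
\<close>

definition has_preadjoint :: "('a \<Rightarrow> complex) \<Rightarrow> bool" where
  "has_preadjoint h \<longleftrightarrow> h \<in> L1 \<mu> \<and>
    (\<exists>g\<in>L1 \<nu>. \<forall>f\<in>Linf \<nu>. (\<integral>t. induced_map Y \<alpha> f t * h t \<partial>\<mu>) = (\<integral>x. f x * g x \<partial>\<nu>))"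

lemma has_preadjoint_add:
  assumes "has_preadjoint h" "has_preadjoint h'"
  shows "has_preadjoint (\<lambda>t. h t + h' t)"
proof -
  obtain g where h: "h \<in> L1 \<mu>" and g: "g \<in> L1 \<nu>"
    and eq: "\<forall>f\<in>Linf \<nu>. (\<integral>t. induced_map Y \<alpha> f t * h t \<partial>\<mu>) = (\<integral>x. f x * g x \<partial>\<nu>)"
    using assms(1) unfolding has_preadjoint_def by blast
  obtain g' where h': "h' \<in> L1 \<mu>" and g': "g' \<in> L1 \<nu>"
    and eq': "\<forall>f\<in>Linf \<nu>. (\<integral>t. induced_map Y \<alpha> f t * h' t \<partial>\<mu>) = (\<integral>x. f x * g' x \<partial>\<nu>)"
    using assms(2) unfolding has_preadjoint_def by blast
  have "(\<integral>t. induced_map Y \<alpha> f t * (h t + h' t) \<partial>\<mu>) = (\<integral>x. f x * (g x + g' x) \<partial>\<nu>)"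
    if f: "f \<in> Linf \<nu>" for f
    using bspec[OF eq f] bspec[OF eq' f]
      Linf_times_L1_integrable[OF f g] Linf_times_L1_integrable[OF f g']
      Linf_times_L1_integrable[OF induced_Linf[OF f] h]
      Linf_times_L1_integrable[OF induced_Linf[OF f] h']
    by (simp add: distrib_left)
  then show ?thesis
    unfolding has_preadjoint_def using g g' h h'
    by (intro conjI bexI[of _ "\<lambda>x. g x + g' x"]) (auto simp: L1_def)
qed

lemma has_preadjoint_scale:
  assumes "has_preadjoint h"
  shows "has_preadjoint (\<lambda>t. c * h t)"
proof -
  obtain g where h: "h \<in> L1 \<mu>" and g: "g \<in> L1 \<nu>"
    and eq: "\<forall>f\<in>Linf \<nu>. (\<integral>t. induced_map Y \<alpha> f t * h t \<partial>\<mu>) = (\<integral>x. f x * g x \<partial>\<nu>)"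
    using assms unfolding has_preadjoint_def by blast
  have "(\<integral>t. induced_map Y \<alpha> f t * (c * h t) \<partial>\<mu>) = (\<integral>x. f x * (c * g x) \<partial>\<nu>)"
    if f: "f \<in> Linf \<nu>" for f
    using bspec[OF eq f] by (simp add: mult.left_commute[of _ c])
  then show ?thesis
    unfolding has_preadjoint_def using g h
    by (intro conjI bexI[of _ "\<lambda>x. c * g x"]) (auto simp: L1_def)
qed

lemma has_preadjoint_nonneg:
  assumes "integrable \<mu> h" "\<And>x. 0 \<le> (h x :: real)"
  shows "has_preadjoint (\<lambda>t. complex_of_real (h t))"
proof -
  obtain D where "integrable \<nu> D"
    "\<And>f. f \<in> borel_measurable \<nu> \<Longrightarrow>
      (\<integral>t. induced_map Y \<alpha> f t * complex_of_real (h t) \<partial>\<mu>) = (\<integral>x. f x * complex_of_real (D x) \<partial>\<nu>)"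
    by (rule preadjoint_nonneg[OF assms]) blast
  then show ?thesis
    unfolding has_preadjoint_def using assms(1)
    by (intro conjI bexI[of _ "\<lambda>x. complex_of_real (D x)"]) (auto simp: L1_def Linf_def)
qed

lemma has_preadjoint_L1:
  assumes "h \<in> L1 \<mu>"
  shows "has_preadjoint h"
proof -
  have h: "integrable \<mu> h" using assms by (simp add: L1_def)
  have Re: "integrable \<mu> (\<lambda>t. Re (h t))" and Im: "integrable \<mu> (\<lambda>t. Im (h t))"
    using h by simp_all
  have part: "has_preadjoint (\<lambda>t. complex_of_real (max 0 (k t)))" if "integrable \<mu> k" for k
    using that by (intro has_preadjoint_nonneg) auto
  have signed: "has_preadjoint (\<lambda>t. complex_of_real (k t))" if "integrable \<mu> k" for k
  proof -
    have neg: "integrable \<mu> (\<lambda>t. - k t)" using that by simp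
    have "has_preadjoint (\<lambda>t. complex_of_real (max 0 (k t)) + (- 1) * complex_of_real (max 0 (- k t)))"
      by (intro has_preadjoint_add has_preadjoint_scale part that neg)
    moreover have "(\<lambda>t. complex_of_real (max 0 (k t)) + (- 1) * complex_of_real (max 0 (- k t)))
        = (\<lambda>t. complex_of_real (k t))"
      by (auto simp: max_def)
    ultimately show ?thesis by simp
  qed
  have "has_preadjoint (\<lambda>t. complex_of_real (Re (h t)) + \<i> * complex_of_real (Im (h t)))"
    by (intro has_preadjoint_add has_preadjoint_scale signed Re Im)
  moreover have "(\<lambda>t. complex_of_real (Re (h t)) + \<i> * complex_of_real (Im (h t))) = h"
    by (rule ext, rule complex_eq[symmetric])
  ultimately show ?thesis by simp
qed

lemma induced_wstar_continuous:
  "continuous_map (wstar_topology \<nu>) (wstar_topology \<mu>) (induced_map Y \<alpha>)"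
  unfolding wstar_topology_def[of \<mu>]
proof (rule continuous_map_pullback')
  let ?J = "\<lambda>f. \<lambda>h\<in>L1 \<mu>. \<integral>t. f t * h t \<partial>\<mu>"
  show "continuous_map (wstar_topology \<nu>) (product_topology (\<lambda>_. euclidean) (L1 \<mu>))
      (?J \<circ> induced_map Y \<alpha>)"
    unfolding continuous_map_componentwise
  proof (intro conjI ballI)
    show "(?J \<circ> induced_map Y \<alpha>) ` topspace (wstar_topology \<nu>) \<subseteq> extensional (L1 \<mu>)"
      by auto
    fix h assume h: "h \<in> L1 \<mu>"
    obtain g where g: "g \<in> L1 \<nu>"
      and eq: "\<forall>f\<in>Linf \<nu>. (\<integral>t. induced_map Y \<alpha> f t * h t \<partial>\<mu>) = (\<integral>x. f x * g x \<partial>\<nu>)"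
      using has_preadjoint_L1[OF h] unfolding has_preadjoint_def by blast
    show "continuous_map (wstar_topology \<nu>) euclidean (\<lambda>f. (?J \<circ> induced_map Y \<alpha>) f h)"
      using h eq by (intro continuous_map_eq[OF wstar_functional_continuous[OF g]])
        (auto simp: wstar_topspace)
  qed
  show "topspace (wstar_topology \<nu>) \<subseteq> induced_map Y \<alpha> -` Linf \<mu>"
    using induced_Linf by (auto simp: wstar_topspace)
qed

end

section \<open>The equivalence\<close>

lemma mixed_piecewise_affine_pieces:
  assumes "mixed_piecewise_affine Y \<alpha>"
  obtains I :: "nat set" and Ys Cs \<beta> where "finite I" "Y = (\<Union>i\<in>I. Ys i)"
    "\<And>i. i \<in> I \<Longrightarrow> open (Ys i)" "\<And>i. i \<in> I \<Longrightarrow> Ys i \<subseteq> Cs i"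
    "\<And>i. i \<in> I \<Longrightarrow> open (Cs i)" "\<And>i. i \<in> I \<Longrightarrow> heap_closed (Cs i)"
    "\<And>i. i \<in> I \<Longrightarrow> continuous_on (Cs i) (\<beta> i)"
    "\<And>i. i \<in> I \<Longrightarrow> heap_hom (Cs i) (\<beta> i) \<or> heap_antihom (Cs i) (\<beta> i)"
    "\<And>i t. i \<in> I \<Longrightarrow> t \<in> Ys i \<Longrightarrow> \<alpha> t = \<beta> i t"
proof -
  from assms obtain m :: nat and Ys Cs \<beta> where Y: "Y = (\<Union>i\<in>{1..m}. Ys i)"
    and p: "\<forall>i\<in>{1..m}. open (Ys i) \<and> closed (Ys i) \<and> Ys i \<in> open_coset_ring \<and>
           Cs i \<in> open_cosets \<and> Ys i \<subseteq> Cs i \<and> continuous_on (Cs i) (\<beta> i) \<and>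
           (affine_map (Cs i) (\<beta> i) \<or> anti_affine_map (Cs i) (\<beta> i)) \<and>
           (\<forall>t\<in>Ys i. \<alpha> t = \<beta> i t)"
    unfolding mixed_piecewise_affine_def by (elim exE conjE) blast
  show thesis
  proof (rule that[OF _ Y, of Cs \<beta>])
    fix i assume "i \<in> {1..m}"
    with p have i: "open (Ys i)" "Cs i \<in> open_cosets" "Ys i \<subseteq> Cs i" "continuous_on (Cs i) (\<beta> i)"
      "affine_map (Cs i) (\<beta> i) \<or> anti_affine_map (Cs i) (\<beta> i)" "\<forall>t\<in>Ys i. \<alpha> t = \<beta> i t"
      by simp_all
    show "open (Ys i)" "Ys i \<subseteq> Cs i" "continuous_on (Cs i) (\<beta> i)" by fact+
    show "open (Cs i)" "heap_closed (Cs i)" using i(2) by (rule open_coset_heap)+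
    show "heap_hom (Cs i) (\<beta> i) \<or> heap_antihom (Cs i) (\<beta> i)"
      using i(5) affine_heap_hom anti_affine_heap_antihom by blast
    show "\<alpha> t = \<beta> i t" if "t \<in> Ys i" for t using i(6) that by blast
  qed simp
qed

theorem theorem2p7:
  fixes \<mu> :: "'g::{topological_group_add, second_countable_topology, t2_space} measure"
    and \<nu> :: "'f::{topological_group_add, second_countable_topology, t2_space} measure"
    and Y :: "'g set" and \<alpha> :: "'g \<Rightarrow> 'f"
  assumes "locally_compact_space (euclidean :: 'g topology)"
    and "locally_compact_space (euclidean :: 'f topology)"
    and "haar_measure \<mu>" and "haar_measure \<nu>"
    and "open Y" and "closed Y"
    and "mixed_piecewise_affine Y \<alpha>"
  shows "extends_to_wstar_hom \<nu> \<mu> (induced_map Y \<alpha>) \<longleftrightarrow> open_map (top_of_set Y) euclidean \<alpha>"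
proof -
  obtain I :: "nat set" and Ys Cs \<beta> where I: "finite I" "Y = (\<Union>i\<in>I. Ys i)"
    and Ys: "\<And>i. i \<in> I \<Longrightarrow> open (Ys i)" "\<And>i. i \<in> I \<Longrightarrow> Ys i \<subseteq> Cs i"
    and Cs: "\<And>i. i \<in> I \<Longrightarrow> open (Cs i)" "\<And>i. i \<in> I \<Longrightarrow> heap_closed (Cs i)"
    and \<beta>: "\<And>i. i \<in> I \<Longrightarrow> continuous_on (Cs i) (\<beta> i)"
      "\<And>i. i \<in> I \<Longrightarrow> heap_hom (Cs i) (\<beta> i) \<or> heap_antihom (Cs i) (\<beta> i)"
    and \<alpha>: "\<And>i t. i \<in> I \<Longrightarrow> t \<in> Ys i \<Longrightarrow> \<alpha> t = \<beta> i t"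
    by (rule mixed_piecewise_affine_pieces[OF assms(7)]) blast
  have \<alpha>_image: "\<alpha> ` S = \<beta> i ` S" if "i \<in> I" "S \<subseteq> Ys i" for i S
    using \<alpha>[OF that(1)] that(2) by (intro image_cong) auto
  have \<alpha>_cont_piece: "continuous_on (Ys i) \<alpha>" if i: "i \<in> I" for i
    using continuous_on_subset[OF \<beta>(1)[OF i] Ys(2)[OF i]] \<alpha>[OF i] by (simp cong: continuous_on_cong)
  have \<alpha>_cont: "continuous_on Y \<alpha>"
    unfolding I(2) by (rule continuous_on_open_UN[OF Ys(1) \<alpha>_cont_piece])
  have YsY: "Ys i \<subseteq> Y" if "i \<in> I" for i using that I(2) by blast
  show ?thesis
  proof
    assume ext: "extends_to_wstar_hom \<nu> \<mu> (induced_map Y \<alpha>)"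
    \<comment> \<open>compact sets with interior are not null, hence, as an extension exists, neither are their images\<close>
    have piece: "open (\<beta> i ` U)" if i: "i \<in> I" and U: "open U" "U \<subseteq> Ys i" for i U
    proof (rule heap_map_open[OF assms(1,4) \<beta>(1)[OF i] \<beta>(2)[OF i] Ys(2)[OF i] _ U])
      fix K assume K: "compact K" "interior K \<noteq> {}" "K \<subseteq> Ys i"
      have "0 < emeasure \<mu> (interior K)" by (rule haar_open_pos[OF assms(3) open_interior K(2)])
      also have "\<dots> \<le> emeasure \<mu> K"
        using K(1) by (intro emeasure_mono interior_subset)
          (simp add: haar_sets[OF assms(3)] compact_imp_closed)
      finally have "0 < emeasure \<nu> (\<alpha> ` K)"
        using YsY[OF i] K(3)
        by (intro extension_image_not_null[OF assms(2-4) ext K(1)] continuous_on_subset[OF \<alpha>_cont]) auto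
      then show "0 < emeasure \<nu> (\<beta> i ` K)" unfolding \<alpha>_image[OF i K(3)] .
    qed
    show "open_map (top_of_set Y) euclidean \<alpha>"
      unfolding open_map_def
    proof (intro allI impI)
      fix U assume "openin (top_of_set Y) U"
      then have U: "open U" "U \<subseteq> Y" using assms(5) by (auto simp: openin_open_eq)
      have "\<alpha> ` U = (\<Union>i\<in>I. \<beta> i ` (U \<inter> Ys i))"
      proof -
        have "U = (\<Union>i\<in>I. U \<inter> Ys i)" using U(2) I(2) by blast
        then have "\<alpha> ` U = (\<Union>i\<in>I. \<alpha> ` (U \<inter> Ys i))" by (metis image_UN)
        also have "\<dots> = (\<Union>i\<in>I. \<beta> i ` (U \<inter> Ys i))"
          using \<alpha>_image by (intro SUP_cong refl) auto
        finally show ?thesis .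
      qed
      moreover have "open (\<Union>i\<in>I. \<beta> i ` (U \<inter> Ys i))"
      proof (intro open_UN ballI)
        fix i assume i: "i \<in> I"
        show "open (\<beta> i ` (U \<inter> Ys i))"
          by (rule piece[OF i open_Int[OF U(1) Ys(1)[OF i]] Int_lower2])
      qed
      ultimately show "openin euclidean (\<alpha> ` U)" by simp
    qed
  next
    assume op: "open_map (top_of_set Y) euclidean \<alpha>"
    interpret nonsingular_partial_map \<mu> \<nu> Y \<alpha>
    proof (rule nonsingular_partial_map.intro)
      show "sigma_finite_measure \<nu>" by (rule haar_sigma_finite[OF assms(4,2)])
      show "emeasure \<nu> (space \<nu>) \<noteq> 0"
        using haar_open_pos[OF assms(4) open_UNIV] by (simp add: haar_space[OF assms(4)])
      show Y: "Y \<in> sets \<mu>" using assms(5) by (simp add: haar_sets[OF assms(3)])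
      have "sets (restrict_space \<mu> Y) = sets (restrict_space borel Y)"
        by (rule sets_restrict_space_cong[OF haar_sets[OF assms(3)]])
      then show \<alpha>_meas: "\<alpha> \<in> measurable (restrict_space \<mu> Y) \<nu>"
        using borel_measurable_continuous_on_restrict[OF \<alpha>_cont]
          measurable_cong_sets[OF _ haar_sets[OF assms(4)]] by blast
      fix N assume N: "N \<in> null_sets \<nu>"
      \<comment> \<open>an empty piece is excluded because nothing is known about the image of its coset\<close>
      have "{k\<in>Cs i. \<beta> i k \<in> N} \<in> null_sets \<mu>" if i: "i \<in> I" "Ys i \<noteq> {}" for i
      proof -
        have "openin (top_of_set Y) (Ys i)"
          using Ys(1)[OF i(1)] YsY[OF i(1)] assms(5) by (simp add: openin_open_eq)
        then have "open (\<alpha> ` Ys i)" using op by (simp add: open_map_def)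
        then have U: "open (\<beta> i ` Ys i)" unfolding \<alpha>_image[OF i(1) order_refl] .
        have ne: "\<beta> i ` Ys i \<noteq> {}" using i(2) by simp
        have sub: "\<beta> i ` Ys i \<subseteq> \<beta> i ` Cs i" using Ys(2)[OF i(1)] by (rule image_mono)
        show ?thesis
          using \<beta>(2)[OF i(1)]
        proof
          assume "heap_hom (Cs i) (\<beta> i)"
          then show ?thesis
            by (rule hom_preimage_null[OF assms(1-4) Cs[OF i(1)] \<beta>(1)[OF i(1)] _ U ne sub N])
        next
          assume "heap_antihom (Cs i) (\<beta> i)"
          then show ?thesis
            by (rule antihom_preimage_null[OF assms(1-4) Cs[OF i(1)] \<beta>(1)[OF i(1)] _ U ne sub N])
        qed
      qed
      then have big: "(\<Union>i\<in>{i\<in>I. Ys i \<noteq> {}}. {k\<in>Cs i. \<beta> i k \<in> N}) \<in> null_sets \<mu>"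
        using I(1) by (intro null_sets.finite_UN) auto
      have sub: "{t\<in>Y. \<alpha> t \<in> N} \<subseteq> (\<Union>i\<in>{i\<in>I. Ys i \<noteq> {}}. {k\<in>Cs i. \<beta> i k \<in> N})"
      proof
        fix t assume "t \<in> {t\<in>Y. \<alpha> t \<in> N}"
        then obtain i where i: "i \<in> I" "t \<in> Ys i" "\<alpha> t \<in> N" using I(2) by blast
        then have "t \<in> Cs i" "\<beta> i t \<in> N" using Ys(2)[OF i(1)] \<alpha>[OF i(1,2)] by auto
        then show "t \<in> (\<Union>i\<in>{i\<in>I. Ys i \<noteq> {}}. {k\<in>Cs i. \<beta> i k \<in> N})" using i by blast
      qed
      have meas: "{t\<in>Y. \<alpha> t \<in> N} \<in> sets \<mu>"
      proof -
        have "\<alpha> -` N \<inter> space (restrict_space \<mu> Y) \<in> sets (restrict_space \<mu> Y)"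
          using \<alpha>_meas null_setsD2[OF N] by (rule measurable_sets)
        moreover have "\<alpha> -` N \<inter> space (restrict_space \<mu> Y) = {t\<in>Y. \<alpha> t \<in> N}"
          using haar_space[OF assms(3)] by (auto simp: space_restrict_space)
        ultimately show ?thesis using Y by (simp add: sets_restrict_space_iff)
      qed
      show "{t\<in>Y. \<alpha> t \<in> N} \<in> null_sets \<mu>" by (rule null_sets_subset[OF big meas sub])
    qed
    show "extends_to_wstar_hom \<nu> \<mu> (induced_map Y \<alpha>)"
      unfolding extends_to_wstar_hom_def
      using induced_hom induced_bounded induced_wstar_continuous by (intro exI[of _ "induced_map Y \<alpha>"]) simp
  qed
qed

end
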